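(* Let $\lambda,\mu$ be Dyck paths of the same length $2n$ with $\lambda(i)\le\mu(i)$ for all $i$ (i.e. $\mu\subseteq\lambda$ as partitions). Then $$M^{-1}_{\lambda/\mu} = (-1)^{|\lambda/\mu|}\cdot\bigl|\{\text{cover-inclusive Dyck tilings of }\lambda/\mu\}\bigr|.$$
   Context: A balanced parentheses expression (BPE) of length $2n$ is a word with $n$ symbols "(" and $n$ symbols ")" in which every prefix has at least as many "(" as ")". It corresponds to a Dyck path $h:\{0,\dots,2n\}\to\{0,1,\dots\}$ with $h(0)=h(2n)=0$, $|h(i+1)-h(i)|=1$, where $h(i)$ is the number of "(" minus the number of ")" in the prefix of length $i$. Matched pairs of parentheses are defined as usual. For BPEs $P_1,P_2$ of length $2n$ write $P_1\leftarrow P_2$ if $P_1$ can be obtained from $P_2$ by taking some (possibly none) of the matched pairs of parentheses of $P_2$ and reversing each of them (replacing the "(" by ")" and the ")" by "("). $M$ is the matrix with rows and columns indexed by BPEs of length $2n$ (equivalently, Dyck paths), with $M_{P_1,P_2}=1$ if $P_1\leftarrow P_2$ and $0$ otherwise. It is upper unitriangular in lexicographic order, hence invertible over $\mathbb Z$. For Dyck paths $\lambda\le\mu$ pointwise, $M^{-1}_{\lambda/\mu}$ denotes the entry $M^{-1}_{\lambda,\mu}$ of the inverse matrix $M^{-1}$. Skew shape: each Dyck path is associated with the Young diagram of boxes (unit squares rotated by 45 degrees) that can be placed above it, so $\mu\subseteq\lambda$ as partitions iff $\lambda(i)\le\mu(i)$ for all $i$. The skew Young diagram $\lambda/\mu$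 is the set of boxes between the lower path $\lambda$ and the upper path $\mu$; identifying a box with its center $(i,j)$, it is $\{(i,j)\in\mathbb Z^2: i+j\text{ odd},\ \lambda(i)<j<\mu(i)\}$. $|\lambda/\mu|$ is its number of boxes. A Dyck tile is a set of boxes of the form $\{(a+k,\,b+d(k)):0\le k\le 2m\}$ where $m\ge0$ and $d$ is a Dyck path of length $2m$ (a ribbon whose start and end boxes are at the same height with no box of the tile below them). Its horizontal extent is the interval $[a,a+2m]$. A Dyck tiling of $\lambda/\mu$ is a partition of its set of boxes into Dyck tiles. A tile $T$ covers a tile $T'\neq T$ if some box $(i,j)\in T$ and some box $(i,j')\in T'$ satisfy $j>j'$. A Dyck tiling is cover-inclusive if whenever a tile covers another tile, the horizontal extent of the first is contained in the horizontal extent of the second. *)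

theory Defs
  imports Complex_Main "HOL-Library.Disjoint_Sets"
begin

datatype paren = LP | RP

fun flip :: "paren \<Rightarrow> paren" where
  "flip LP = RP"
| "flip RP = LP"

definition bpe :: "nat \<Rightarrow> paren list set" where
  "bpe n = {w. count_list w LP = n \<and> count_list w RP = n \<and>
               (\<forall>i\<le>length w. count_list (take i w) RP \<le> count_list (take i w) LP)}"

text \<open>The Dyck path of a word. Dyck paths of length \<open>2n\<close> are represented throughout by the
  corresponding elements of \<^term>\<open>bpe n\<close>.\<close>

definition height :: "paren list \<Rightarrow> nat \<Rightarrow> int" where
  "height w i = int (count_list (take i w) LP) - int (count_list (take i w) RP)"

text \<open>An opening and a later closing parenthesis match iff the word strictly between them is
  balanced. Positions are counted from 0.\<close>

definition matched_pairs :: "paren list \<Rightarrow> (nat \<times> nat) set" where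
  "matched_pairs w = {(i, j). i < j \<and> j < length w \<and> w ! i = LP \<and> w ! j = RP \<and>
                              (\<exists>m. take (j - Suc i) (drop (Suc i) w) \<in> bpe m)}"

definition reverse_pairs :: "(nat \<times> nat) set \<Rightarrow> paren list \<Rightarrow> paren list" where
  "reverse_pairs S w =
     map (\<lambda>k. if \<exists>(i, j)\<in>S. k = i \<or> k = j then flip (w ! k) else w ! k) [0..<length w]"

definition obtained_from :: "paren list \<Rightarrow> paren list \<Rightarrow> bool" (infix "\<leftarrow>" 50) where
  "P1 \<leftarrow> P2 \<longleftrightarrow> (\<exists>S\<subseteq>matched_pairs P2. P1 = reverse_pairs S P2)"

text \<open>Square matrices with rows and columns indexed by a finite set \<open>I\<close> are functions of two
  arguments, of which only the values on \<open>I \<times> I\<close> are relevant.  The inverse is normalised to be 0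
  elsewhere, which makes it unique.\<close>

definition is_matrix_inverse_on ::
    "'i set \<Rightarrow> ('i \<Rightarrow> 'i \<Rightarrow> 'a::comm_ring_1) \<Rightarrow> ('i \<Rightarrow> 'i \<Rightarrow> 'a) \<Rightarrow> bool" where
  "is_matrix_inverse_on I A B \<longleftrightarrow>
     (\<forall>i\<in>I. \<forall>j\<in>I. (\<Sum>k\<in>I. A i k * B k j) = (if i = j then 1 else 0)) \<and>
     (\<forall>i\<in>I. \<forall>j\<in>I. (\<Sum>k\<in>I. B i k * A k j) = (if i = j then 1 else 0))"

definition matrix_inverse_on ::
    "'i set \<Rightarrow> ('i \<Rightarrow> 'i \<Rightarrow> 'a::comm_ring_1) \<Rightarrow> 'i \<Rightarrow> 'i \<Rightarrow> 'a" where
  "matrix_inverse_on I A =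
     (THE B. is_matrix_inverse_on I A B \<and> (\<forall>i j. i \<notin> I \<or> j \<notin> I \<longrightarrow> B i j = 0))"

lemma matrix_inverse_on_eq:
  assumes "finite I" "is_matrix_inverse_on I A B" "i \<in> I" "j \<in> I"
  shows "matrix_inverse_on I A i j = B i j"
proof -
  have uniq: "C r s = D r s"
    if C: "is_matrix_inverse_on I A C" and D: "is_matrix_inverse_on I A D"
      and r: "r \<in> I" and s: "s \<in> I" for C D r s
  proof -
    have "C r s = (\<Sum>k\<in>I. C r k * (if k = s then 1 else 0))"
      using assms(1) s by (simp add: if_distrib cong: if_cong)
    also have "\<dots> = (\<Sum>k\<in>I. C r k * (\<Sum>l\<in>I. A k l * D l s))"
      using D s by (intro sum.cong) (simp_all add: is_matrix_inverse_on_def)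
    also have "\<dots> = (\<Sum>k\<in>I. \<Sum>l\<in>I. C r k * A k l * D l s)"
      by (simp add: sum_distrib_left mult.assoc)
    also have "\<dots> = (\<Sum>l\<in>I. \<Sum>k\<in>I. C r k * A k l * D l s)"
      by (rule sum.swap)
    also have "\<dots> = (\<Sum>l\<in>I. (\<Sum>k\<in>I. C r k * A k l) * D l s)"
      by (simp add: sum_distrib_right)
    also have "\<dots> = (\<Sum>l\<in>I. (if r = l then 1 else 0) * D l s)"
      using C r by (intro sum.cong) (simp_all add: is_matrix_inverse_on_def)
    also have "\<dots> = D r s"
      using assms(1) r by (simp add: if_distrib[of "\<lambda>x. x * _"] cong: if_cong)
    finally show ?thesis .
  qed
  define B' where "B' r s = (if r \<in> I \<and> s \<in> I then B r s else 0)" for r s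
  have B': "is_matrix_inverse_on I A B'"
    using assms(2) by (simp add: is_matrix_inverse_on_def B'_def)
  have "matrix_inverse_on I A = B'"
    unfolding matrix_inverse_on_def
  proof (rule the_equality)
    show "is_matrix_inverse_on I A B' \<and> (\<forall>i j. i \<notin> I \<or> j \<notin> I \<longrightarrow> B' i j = 0)"
      using B' by (auto simp: B'_def)
  next
    fix C assume C: "is_matrix_inverse_on I A C \<and> (\<forall>i j. i \<notin> I \<or> j \<notin> I \<longrightarrow> C i j = 0)"
    show "C = B'"
    proof (intro ext)
      fix r s show "C r s = B' r s"
        using C uniq[of C B' r s] B' by (cases "r \<in> I \<and> s \<in> I") (auto simp: B'_def)
    qed
  qed
  then show ?thesis using assms by (simp add: B'_def)
qed

definition bpe_matrix :: "paren list \<Rightarrow> paren list \<Rightarrow> int" where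
  "bpe_matrix P1 P2 = (if P1 \<leftarrow> P2 then 1 else 0)"

definition bpe_matrix_inverse :: "nat \<Rightarrow> paren list \<Rightarrow> paren list \<Rightarrow> int" where
  "bpe_matrix_inverse n = matrix_inverse_on (bpe n) bpe_matrix"

text \<open>A box is identified with its centre, a point \<open>(i, j)\<close> with \<open>i + j\<close> odd.\<close>

type_synonym box = "int \<times> int"

definition skew_shape :: "nat \<Rightarrow> paren list \<Rightarrow> paren list \<Rightarrow> box set" where
  "skew_shape n lam mu =
     {(int i, j) | i j. i \<le> 2 * n \<and> odd (int i + j) \<and> height lam i < j \<and> j < height mu i}"

definition dyck_tile :: "box set \<Rightarrow> bool" where
  "dyck_tile T \<longleftrightarrow>
     (\<exists>a b m. odd (a + b) \<and> (\<exists>d\<in>bpe m. T = {(a + int k, b + height d k) | k. k \<le> 2 * m}))"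

definition dyck_tiling :: "nat \<Rightarrow> paren list \<Rightarrow> paren list \<Rightarrow> box set set \<Rightarrow> bool" where
  "dyck_tiling n lam mu D \<longleftrightarrow> partition_on (skew_shape n lam mu) D \<and> (\<forall>T\<in>D. dyck_tile T)"

definition covers :: "box set \<Rightarrow> box set \<Rightarrow> bool" where
  "covers T T' \<longleftrightarrow> T \<noteq> T' \<and> (\<exists>i j j'. (i, j) \<in> T \<and> (i, j') \<in> T' \<and> j > j')"

text \<open>The columns met by a Dyck tile are consecutive, so its horizontal extent is the (integer)
  interval of their abscissae.\<close>

definition extent :: "box set \<Rightarrow> int set" where
  "extent T = fst ` T"

lemma extent_dyck_tile:
  "extent {(a + int k, b + height d k) | k. k \<le> 2 * m} = {a..a + 2 * int m}"
proof
  show "{a..a + 2 * int m} \<subseteq> extent {(a + int k, b + height d k) | k. k \<le> 2 * m}"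
  proof
    fix x assume "x \<in> {a..a + 2 * int m}"
    then have "x = fst (a + int (nat (x - a)), b + height d (nat (x - a)))" "nat (x - a) \<le> 2 * m"
      by auto
    then show "x \<in> extent {(a + int k, b + height d k) | k. k \<le> 2 * m}"
      unfolding extent_def by blast
  qed
qed (auto simp: extent_def)

definition cover_inclusive :: "box set set \<Rightarrow> bool" where
  "cover_inclusive D \<longleftrightarrow> (\<forall>T\<in>D. \<forall>T'\<in>D. covers T T' \<longrightarrow> extent T \<subseteq> extent T')"

end

theory Submission
  imports Defs
begin

text \<open>
  Let \<open>N\<close> be the matrix of signed numbers of cover-inclusive Dyck tilings, with entry 0 if the
  lower path is not below the upper one, and let \<open>M\<close> be the matrix to be inverted. The proof that
  \<open>N * M = 1\<close> is an induction on \<open>n\<close> that deletes a peak of the upper path.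

  Let \<open>mu\<close> have a peak, that is, an adjacent pair of letters \<open>LP\<close>, \<open>RP\<close>; let \<open>mu1\<close> be \<open>mu\<close> with this
  peak turned into a valley and \<open>mu'\<close> be \<open>mu\<close> with the two letters deleted. In a cover-inclusive
  tiling of \<open>lam/mu\<close>, consider the box just under the peak, if there is one. If it forms a tile by
  itself, removing it leaves an arbitrary cover-inclusive tiling of \<open>lam/mu1\<close>. Otherwise the tile
  containing it passes through it from one side to the other, with a peak there, and
  cover-inclusiveness passes this property on to all tiles in that column, down to \<open>lam\<close>. So \<open>lam\<close>
  has a peak in the same place; it also does if there is no box under the peak of \<open>mu\<close>, because
  then the paths touch there. The peaks of the two paths and of all these tiles can be deleted simultaneously,
  which gives an arbitrary cover-inclusive tiling of \<open>lam'/mu'\<close>. As the number of boxes drops by 1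
  in the first case and keeps its parity in the second, this is the recurrence
  \<open>N lam mu + N lam mu1 = N lam' mu'\<close> if \<open>lam\<close> has a peak in this place, with right-hand side 0
  otherwise (\<open>signed_count_recurrence\<close>, resting on \<open>ci_tilings_insert_top\<close>,
  \<open>ci_tilings_no_single\<close> and \<open>ci_tilings_vimage\<close>).

  On the other side, the letters of a peak match each other and deleting them does not affect the
  other matched pairs. So the words obtained from \<open>mu\<close> by reversals are those obtained from \<open>mu'\<close>
  with either a peak or a valley inserted (\<open>obtained_from_peak\<close>). Summed over such a pair of words,
  \<open>N\<close> satisfies the recurrence, so the entry of \<open>N * M\<close> at \<open>lam\<close>, \<open>mu\<close> is the one at \<open>lam'\<close>, \<open>mu'\<close>
  or 0 (\<open>signed_count_left_inverse\<close>). Unitriangularity of \<open>N\<close> turns the left inverse into a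
  two-sided one.
\<close>

section \<open>Heights and insertion of peaks and valleys\<close>

lemma paren_neq_LP: "(x \<noteq> LP) = (x = RP)" by (cases x) auto

lemma count_LP_RP: "count_list w LP + count_list w RP = length w"
proof (induction w)
  case (Cons x w) then show ?case by (cases x) auto
qed simp

lemma height_0 [simp]: "height w 0 = 0"
  by (simp add: height_def)

lemma height_Suc:
  "i < length w \<Longrightarrow> height w (Suc i) = height w i + (if w ! i = LP then 1 else -1)"
  by (cases "w ! i") (simp_all add: height_def take_Suc_conv_app_nth)

lemma height_append:
  "height (u @ v) i = height u i + height v (i - length u)"
  by (simp add: height_def)

lemma even_height: "i \<le> length w \<Longrightarrow> even (height w i + int i)"
  by (induction i) (auto simp: height_Suc)

lemma height_take_drop:
  assumes "a \<le> b" "b \<le> length w" "i \<le> b - a"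
  shows "height (take (b - a) (drop a w)) i = height w (a + i) - height w a"
proof -
  have "take (a + i) w = take a w @ take i (drop a w)"
    by (simp add: take_add)
  then show ?thesis using assms by (simp add: height_def)
qed

lemma bpe_iff:
  "w \<in> bpe n \<longleftrightarrow> length w = 2 * n \<and> height w (2 * n) = 0 \<and> (\<forall>i\<le>2 * n. 0 \<le> height w i)"
  (is "_ \<longleftrightarrow> ?R")
proof
  assume "w \<in> bpe n"
  then show ?R using count_LP_RP[of w] by (auto simp: bpe_def height_def)
next
  assume ?R
  then show "w \<in> bpe n" using count_LP_RP[of w] by (auto simp: bpe_def height_def)
qed

lemma bpe_length: "w \<in> bpe n \<Longrightarrow> length w = 2 * n"
  by (simp add: bpe_iff)

lemma finite_bpe [simp]: "finite (bpe n)"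
proof -
  have "UNIV = {LP, RP}" by (auto intro: paren.exhaust)
  then have "finite (UNIV :: paren set)" by (metis finite.emptyI finite.insertI)
  then have "finite {w :: paren list. set w \<subseteq> UNIV \<and> length w = 2 * n}"
    by (rule finite_lists_length_eq)
  then show ?thesis by (rule rev_finite_subset) (auto simp: bpe_length)
qed

lemma height_eqI:
  assumes "length v = length w" "\<And>i. i \<le> length w \<Longrightarrow> height v i = height w i"
  shows "v = w"
proof (rule nth_equalityI)
  fix i assume "i < length v"
  then have "height v (Suc i) = height w (Suc i)" "height v i = height w i"
    "i < length w" using assms by auto
  then show "v ! i = w ! i" using \<open>i < length v\<close>
    by (cases "v ! i"; cases "w ! i") (simp_all add: height_Suc)
qed (rule assms)

text \<open>Insertion is the basic operation, rather than deletion or reversal at a given position, because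
  the induction on \<open>n\<close> compares \<open>peak k w\<close>, \<open>valley k w\<close> and \<open>w\<close>.\<close>

definition peak :: "nat \<Rightarrow> paren list \<Rightarrow> paren list" where
  "peak k w = take k w @ LP # RP # drop k w"

definition valley :: "nat \<Rightarrow> paren list \<Rightarrow> paren list" where
  "valley k w = take k w @ RP # LP # drop k w"

definition contract :: "nat \<Rightarrow> paren list \<Rightarrow> paren list" where
  "contract k w = take k w @ drop (k + 2) w"

lemma length_peak [simp]: "length (peak k w) = Suc (Suc (length w))"
  and length_valley [simp]: "length (valley k w) = Suc (Suc (length w))"
  by (simp_all add: peak_def valley_def)

text \<open>Inserting a pair of distinct letters leaves the path unchanged to the left of the new extremum
  and translates it horizontally by 2 to its right, so only the height at \<open>k + 1\<close> is new.\<close>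

lemma height_insert:
  assumes "k \<le> length w" "x \<noteq> y"
  shows "height (take k w @ x # y # drop k w) i =
    (if i \<le> k then height w i
     else if i = k + 1 then height w k + (if x = LP then 1 else -1) else height w (i - 2))"
proof -
  have *: "height w j = height (take k w) j + height (drop k w) (j - k)" for j
    using height_append[of "take k w" "drop k w" j] assms by simp
  have xy: "x = LP \<and> y = RP \<or> x = RP \<and> y = LP" using assms by (cases x; cases y) auto
  consider "i \<le> k" | "i = k + 1" | j where "i = Suc (Suc (k + j))"
    by (metis Suc_eq_plus1 add_Suc_right less_iff_Suc_add not_less not_less_eq_eq le_Suc_eq add.commute nat_le_iff_add)
  then show ?thesis
  proof cases
    case 1 then show ?thesis using assms by (simp add: height_append * [of i])
  next
    case 2 then show ?thesis using assms xy by (auto simp: height_append height_def take_Cons')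
  next
    case 3
    then have "height w (i - 2) = height (take k w) (k + j) + height (drop k w) j"
      by (simp add: * [of "k + j"])
    then show ?thesis using assms xy 3 by (auto simp: height_append height_def)
  qed
qed

lemma height_peak:
  assumes "k \<le> length w"
  shows "height (peak k w) i =
    (if i \<le> k then height w i else if i = k + 1 then height w k + 1 else height w (i - 2))"
  using height_insert[OF assms, of LP RP i] by (simp add: peak_def)

lemma height_valley:
  assumes "k \<le> length w"
  shows "height (valley k w) i =
    (if i \<le> k then height w i else if i = k + 1 then height w k - 1 else height w (i - 2))"
  using height_insert[OF assms, of RP LP i] by (simp add: valley_def)

lemma peak_in_bpe_iff:
  assumes "k \<le> length w"
  shows "peak k w \<in> bpe (Suc n) \<longleftrightarrow> w \<in> bpe n"
proof -
  have "(\<forall>i\<le>2 * Suc n. 0 \<le> height (peak k w) i) \<longleftrightarrow> (\<forall>i\<le>2 * n. 0 \<le> height w i)"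
    (is "?L \<longleftrightarrow> ?R") if len: "length w = 2 * n"
  proof
    assume ?L
    show ?R
    proof (intro allI impI)
      fix i assume "i \<le> 2 * n"
      then show "0 \<le> height w i"
        using \<open>?L\<close>[rule_format, of "if i \<le> k then i else i + 2"] assms len
        by (cases "i \<le> k") (auto simp: height_peak)
    qed
  next
    assume R: ?R
    show ?L
    proof (intro allI impI)
      fix i assume "i \<le> 2 * Suc n"
      then have "0 \<le> height w (i - 2)" "0 \<le> height w k" "i \<le> k \<Longrightarrow> 0 \<le> height w i"
        using R assms len by auto
      then show "0 \<le> height (peak k w) i" using assms by (simp add: height_peak)
    qed
  qed
  moreover have "height (peak k w) (2 * Suc n) = height w (2 * n)" if "length w = 2 * n"
    using that assms by (simp add: height_peak)
  ultimately show ?thesis unfolding bpe_iff by auto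
qed

text \<open>Only one direction holds for valleys: the inserted minimum may fall below the axis. Those words
  are handled later by \<open>signed_count_not_bpe\<close>.\<close>

lemma valley_in_bpe_imp:
  assumes "k \<le> length w" "valley k w \<in> bpe (Suc n)"
  shows "w \<in> bpe n"
proof -
  have len: "length w = 2 * n" and *: "\<And>i. i \<le> 2 * n + 2 \<Longrightarrow> 0 \<le> height (valley k w) i"
    and "height (valley k w) (2 * n + 2) = 0"
    using assms by (auto simp: bpe_iff)
  moreover have "0 \<le> height w i" if "i \<le> 2 * n" for i
    using *[of "if i \<le> k then i else i + 2"] assms len that
    by (cases "i \<le> k") (auto simp: height_valley)
  ultimately show ?thesis using assms by (auto simp: bpe_iff height_valley)
qed

text \<open>The first closing parenthesis is preceded by an opening one.\<close>

lemma bpe_has_peak: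
  assumes "w \<in> bpe (Suc n)"
  obtains k w' where "k \<le> length w'" "w = peak k w'" "w' \<in> bpe n"
proof -
  have "RP \<in> set w" using assms count_notin[of RP w] by (auto simp: bpe_def)
  then obtain a b where ab: "w = a @ RP # b" "RP \<notin> set a" by (meson split_list_first)
  have "a \<noteq> []"
  proof
    assume "a = []"
    moreover have "0 \<le> height w 1" "0 < length w" using assms by (auto simp: bpe_iff)
    ultimately show False using ab height_Suc[of 0 w] by simp
  qed
  then obtain c x where "a = c @ [x]" by (metis rev_exhaust)
  with ab have w: "w = c @ LP # RP # b" by (cases x) auto
  show ?thesis
  proof (rule that[of "length c" "c @ b"])
    show "w = peak (length c) (c @ b)" by (simp add: w peak_def)
    then show "c @ b \<in> bpe n" using assms peak_in_bpe_iff[of "length c" "c @ b"] by simp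
  qed simp
qed

section \<open>Matched pairs and reversals at a peak\<close>

text \<open>With heights in place of subwords, the effect of an insertion on matching can be read off from
  \<open>height_peak\<close>.\<close>

lemma matched_pairs_iff:
  "(i, j) \<in> matched_pairs w \<longleftrightarrow> i < j \<and> j < length w \<and> w ! i = LP \<and> w ! j = RP \<and>
     height w j = height w (Suc i) \<and> (\<forall>l. Suc i \<le> l \<and> l \<le> j \<longrightarrow> height w (Suc i) \<le> height w l)"
proof (cases "i < j \<and> j < length w")
  case True
  define x where "x = take (j - Suc i) (drop (Suc i) w)"
  have len: "length x = j - Suc i" using True by (auto simp: x_def)
  have h: "height x l = height w (Suc i + l) - height w (Suc i)" if "l \<le> j - Suc i" for l
    unfolding x_def using True that by (intro height_take_drop) auto
  have "(\<exists>m. x \<in> bpe m) \<longleftrightarrow>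
      height x (j - Suc i) = 0 \<and> (\<forall>l\<le>j - Suc i. 0 \<le> height x l)" (is "_ \<longleftrightarrow> ?R")
  proof
    assume "\<exists>m. x \<in> bpe m"
    then obtain m where "x \<in> bpe m" ..
    then show ?R using len by (auto simp: bpe_iff)
  next
    assume R: ?R
    have "even (int (j - Suc i))" using even_height[of "j - Suc i" x] len R by simp
    then have "2 * ((j - Suc i) div 2) = j - Suc i" by simp
    then show "\<exists>m. x \<in> bpe m" using R len by (intro exI[of _ "(j - Suc i) div 2"]) (simp add: bpe_iff)
  qed
  also have "\<dots> \<longleftrightarrow> height w j = height w (Suc i) \<and>
      (\<forall>l. Suc i \<le> l \<and> l \<le> j \<longrightarrow> height w (Suc i) \<le> height w l)"
  proof -
    have "(\<forall>l\<le>j - Suc i. 0 \<le> height x l) \<longleftrightarrow>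
      (\<forall>l. Suc i \<le> l \<and> l \<le> j \<longrightarrow> height w (Suc i) \<le> height w l)" (is "?A \<longleftrightarrow> ?B")
    proof
      assume A: ?A
      show ?B
      proof (intro allI impI)
        fix l assume l: "Suc i \<le> l \<and> l \<le> j"
        then have "l - Suc i \<le> j - Suc i" by linarith
        with l show "height w (Suc i) \<le> height w l"
          using A[rule_format, of "l - Suc i"] h[of "l - Suc i"] by simp
      qed
    next
      assume ?B then show ?A using h True by auto
    qed
    then show ?thesis using h[of "j - Suc i"] True by simp
  qed
  finally show ?thesis using True unfolding x_def by (auto simp: matched_pairs_def)
qed (auto simp: matched_pairs_def)

text \<open>The new position of the letter at position \<open>i\<close> after two letters are inserted at \<open>k\<close>.\<close>

definition shift :: "nat \<Rightarrow> nat \<Rightarrow> nat" where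
  "shift k i = (if i < k then i else i + 2)"

lemma nth_peak:
  assumes "k \<le> length w"
  shows "peak k w ! shift k i = w ! i" "peak k w ! k = LP" "peak k w ! Suc k = RP"
  using assms by (auto simp: peak_def shift_def nth_append)

lemma nth_valley:
  assumes "k \<le> length w"
  shows "valley k w ! shift k i = w ! i" "valley k w ! k = RP" "valley k w ! Suc k = LP"
  using assms by (auto simp: valley_def shift_def nth_append)

lemma shift_cases:
  obtains "j = k" | "j = Suc k" | i where "j = shift k i"
proof (cases "j < k")
  case True then show ?thesis using that(3)[of j] by (simp add: shift_def)
next
  case False
  then have "j = k \<or> j = Suc k \<or> j = shift k (j - 2)" unfolding shift_def by arith
  then consider "j = k" | "j = Suc k" | "j = shift k (j - 2)" by blast
  then show ?thesis using that by cases
qed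

lemma shift_simps [simp]:
  "shift k i = shift k j \<longleftrightarrow> i = j" "shift k i < shift k j \<longleftrightarrow> i < j"
  "shift k i \<noteq> k" "shift k i \<noteq> Suc k" "k \<noteq> shift k i" "Suc k \<noteq> shift k i"
  by (auto simp: shift_def)

lemma shift_less_length:
  "k \<le> length (w :: 'a list) \<Longrightarrow> shift k i < Suc (Suc (length w)) \<longleftrightarrow> i < length w"
  by (auto simp: shift_def)

lemma height_peak_Suc_shift:
  assumes "k \<le> length w" shows "height (peak k w) (Suc (shift k i)) = height w (Suc i)"
  using assms by (auto simp: height_peak shift_def)

text \<open>The inserted peak lies at or above the level of the path at \<open>k\<close>, so it can neither block nor
  create a match between two old letters.\<close>

lemma matched_pairs_peak_shift:
  assumes k: "k \<le> length w"
  shows "(shift k i, shift k j) \<in> matched_pairs (peak k w) \<longleftrightarrow> (i, j) \<in> matched_pairs w"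
proof -
  have hj: "height (peak k w) (shift k j) = height w j"
    using k by (auto simp: height_peak shift_def)
  have "(\<forall>l. Suc (shift k i) \<le> l \<and> l \<le> shift k j \<longrightarrow> height w (Suc i) \<le> height (peak k w) l) \<longleftrightarrow>
        (\<forall>l. Suc i \<le> l \<and> l \<le> j \<longrightarrow> height w (Suc i) \<le> height w l)" (is "?A \<longleftrightarrow> ?B")
  proof
    assume A: ?A
    show ?B
    proof (intro allI impI)
      fix l assume l: "Suc i \<le> l \<and> l \<le> j"
      have "height (peak k w) (shift k l) = height w l"
        using k by (auto simp: height_peak shift_def)
      moreover have "Suc (shift k i) \<le> shift k l" "shift k l \<le> shift k j"
        using l by (auto simp: shift_def)
      ultimately show "height w (Suc i) \<le> height w l" using A by metis
    qed
  next
    assume B: ?B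
    show ?A
    proof (intro allI impI)
      fix l assume l: "Suc (shift k i) \<le> l \<and> l \<le> shift k j"
      consider "l \<le> k" | "l = k + 1" | "k + 2 \<le> l" by linarith
      then show "height w (Suc i) \<le> height (peak k w) l"
      proof cases
        case 1
        then show ?thesis using B[rule_format, of l] l k by (auto simp: height_peak shift_def split: if_splits)
      next
        \<comment> \<open>the top of the peak, one above the old height at \<open>k\<close>\<close>
        case 2
        then show ?thesis using B[rule_format, of k] l k by (auto simp: height_peak shift_def split: if_splits)
      next
        case 3
        then have "height w (Suc i) \<le> height w (l - 2)"
          using B l by (intro B[rule_format]) (auto simp: shift_def split: if_splits)
        then show ?thesis using 3 k by (simp add: height_peak)
      qed
    qed
  qed
  then show ?thesis using k
    by (simp add: matched_pairs_iff nth_peak shift_less_length hj height_peak_Suc_shift)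
qed

text \<open>The two inserted letters match each other, since the path turns down right after the first one.\<close>

lemma matched_pairs_peak:
  assumes k: "k \<le> length w"
  shows "matched_pairs (peak k w) = insert (k, Suc k) (map_prod (shift k) (shift k) ` matched_pairs w)"
proof (rule set_eqI, clarify)
  fix i j
  let ?P = "peak k w" and ?R = "map_prod (shift k) (shift k) ` matched_pairs w"
  have own: "(k, Suc k) \<in> matched_pairs ?P"
    using k by (auto simp: matched_pairs_iff nth_peak le_Suc_eq)
  show "(i, j) \<in> matched_pairs ?P \<longleftrightarrow> (i, j) \<in> insert (k, Suc k) ?R"
  proof
    assume ij: "(i, j) \<in> matched_pairs ?P"
    then have less: "i < j" and letters: "?P ! i = LP" "?P ! j = RP" and hj: "height ?P j = height ?P (Suc i)"
      and above: "\<And>l. Suc i \<le> l \<Longrightarrow> l \<le> j \<Longrightarrow> height ?P (Suc i) \<le> height ?P l"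
      by (auto simp: matched_pairs_iff)
    have "i \<noteq> Suc k" "j \<noteq> k" using letters nth_peak[OF k] by auto
    moreover have "j = Suc k" if "i = k"
      using above[of "k + 2"] that less \<open>j \<noteq> k\<close> k by (cases "j = Suc k") (auto simp: height_peak)
    moreover have "i = k" if "j = Suc k"
      using above[of k] that less hj k by (cases "i = k") (auto simp: height_peak)
    ultimately consider "i = k" "j = Suc k" | i' j' where "i = shift k i'" "j = shift k j'"
      by (metis shift_cases)
    then show "(i, j) \<in> insert (k, Suc k) ?R"
      using ij matched_pairs_peak_shift[OF k] by cases auto
  next
    assume "(i, j) \<in> insert (k, Suc k) ?R"
    then show "(i, j) \<in> matched_pairs ?P"
      using own matched_pairs_peak_shift[OF k] by auto
  qed
qed

lemma length_reverse_pairs [simp]: "length (reverse_pairs S w) = length w"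
  by (simp add: reverse_pairs_def)

lemma nth_reverse_pairs:
  "l < length w \<Longrightarrow> reverse_pairs S w ! l =
     (if \<exists>(i, j)\<in>S. l = i \<or> l = j then flip (w ! l) else w ! l)"
  by (simp add: reverse_pairs_def)

lemma nth_eqI_shift:
  assumes "length v = length w + 2" "length z = length w + 2" "k \<le> length w"
    "v ! k = z ! k" "v ! Suc k = z ! Suc k" "\<And>i. i < length w \<Longrightarrow> v ! shift k i = z ! shift k i"
  shows "v = z"
proof (rule nth_equalityI)
  fix l assume "l < length v"
  then have "l < length w + 2" using assms by simp
  then show "v ! l = z ! l"
    using assms(3-6) by (cases rule: shift_cases[of l k]) (auto simp: shift_less_length)
qed (use assms in simp)

lemma reverse_pairs_peak:
  assumes k: "k \<le> length w" and S: "S \<subseteq> matched_pairs w"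
  defines "T \<equiv> map_prod (shift k) (shift k) ` S"
  shows "reverse_pairs T (peak k w) = peak k (reverse_pairs S w)"
    and "reverse_pairs (insert (k, Suc k) T) (peak k w) = valley k (reverse_pairs S w)"
proof -
  have T: "(\<exists>(i, j)\<in>T. shift k l = i \<or> shift k l = j) \<longleftrightarrow> (\<exists>(i, j)\<in>S. l = i \<or> l = j)"
    "\<not> (\<exists>(i, j)\<in>T. k = i \<or> k = j)" "\<not> (\<exists>(i, j)\<in>T. Suc k = i \<or> Suc k = j)" for l
    by (force simp: T_def)+
  show "reverse_pairs T (peak k w) = peak k (reverse_pairs S w)"
    by (rule nth_eqI_shift[of _ w _ k])
       (use k T in \<open>simp_all add: nth_reverse_pairs nth_peak shift_less_length\<close>)
  show "reverse_pairs (insert (k, Suc k) T) (peak k w) = valley k (reverse_pairs S w)"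
    by (rule nth_eqI_shift[of _ w _ k])
       (use k T in \<open>simp_all add: nth_reverse_pairs nth_peak nth_valley shift_less_length\<close>)
qed

lemma obtained_from_length: "P \<leftarrow> w \<Longrightarrow> length P = length w"
  by (auto simp: obtained_from_def)

text \<open>The column of \<^const>\<open>bpe_matrix\<close> at a word with a peak is determined by the column at the word
  without it: the pair forming the peak is either reversed or not, independently of the others.\<close>

lemma obtained_from_peak:
  assumes k: "k \<le> length w"
  shows "P \<leftarrow> peak k w \<longleftrightarrow> (\<exists>Q. Q \<leftarrow> w \<and> (P = peak k Q \<or> P = valley k Q))"
proof
  assume "P \<leftarrow> peak k w"
  then obtain T where T: "T \<subseteq> matched_pairs (peak k w)" "P = reverse_pairs T (peak k w)"
    by (auto simp: obtained_from_def)
  define S where "S = {(i, j). (shift k i, shift k j) \<in> T}"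
  have S: "S \<subseteq> matched_pairs w"
    using T(1) matched_pairs_peak_shift[OF k] by (auto simp: S_def)
  have "T = map_prod (shift k) (shift k) ` S \<or> T = insert (k, Suc k) (map_prod (shift k) (shift k) ` S)"
  proof -
    have "T - {(k, Suc k)} = map_prod (shift k) (shift k) ` S"
      using T(1) by (force simp: matched_pairs_peak[OF k] S_def image_iff)
    then show ?thesis by blast
  qed
  then have "P = peak k (reverse_pairs S w) \<or> P = valley k (reverse_pairs S w)"
    using T(2) reverse_pairs_peak[OF k S] by auto
  then show "\<exists>Q. Q \<leftarrow> w \<and> (P = peak k Q \<or> P = valley k Q)"
    using S by (auto simp: obtained_from_def)
next
  assume "\<exists>Q. Q \<leftarrow> w \<and> (P = peak k Q \<or> P = valley k Q)"
  then obtain S where S: "S \<subseteq> matched_pairs w"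
    and P: "P = peak k (reverse_pairs S w) \<or> P = valley k (reverse_pairs S w)"
    by (auto simp: obtained_from_def)
  let ?T = "map_prod (shift k) (shift k) ` S"
  have "?T \<subseteq> matched_pairs (peak k w)" "insert (k, Suc k) ?T \<subseteq> matched_pairs (peak k w)"
    using S by (auto simp: matched_pairs_peak[OF k])
  then show "P \<leftarrow> peak k w"
    using P reverse_pairs_peak[OF k S] unfolding obtained_from_def by metis
qed

section \<open>Dyck tiles as graphs of functions\<close>

text \<open>Functions on absolute coordinates replace the words of the definition of \<^const>\<open>dyck_tile\<close>, because
  collapsing columns is composition with a map on the coordinates.\<close>

definition dyck_function :: "int \<Rightarrow> int \<Rightarrow> (int \<Rightarrow> int) \<Rightarrow> bool" where
  "dyck_function a c f \<longleftrightarrow> a \<le> c \<and> odd (a + f a) \<and> f c = f a \<and> (\<forall>x\<in>{a..c}. f a \<le> f x) \<and>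
     (\<forall>x\<in>{a..<c}. \<bar>f (x + 1) - f x\<bar> = 1)"

definition graph_on :: "int \<Rightarrow> int \<Rightarrow> (int \<Rightarrow> int) \<Rightarrow> box set" where
  "graph_on a c f = {(x, f x) | x. a \<le> x \<and> x \<le> c}"

lemma mem_graph_on: "(x, y) \<in> graph_on a c f \<longleftrightarrow> a \<le> x \<and> x \<le> c \<and> y = f x"
  by (auto simp: graph_on_def)

lemma dyck_tile_imp_graph:
  assumes "dyck_tile T"
  obtains a c f where "dyck_function a c f" "T = graph_on a c f"
proof -
  obtain a b m d where odd: "odd (a + b)" and d: "d \<in> bpe m"
    and T: "T = {(a + int k, b + height d k) | k. k \<le> 2 * m}"
    using assms by (auto simp: dyck_tile_def)
  define f where "f x = b + height d (nat (x - a))" for x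
  have len: "length d = 2 * m" using d by (simp add: bpe_iff)
  have step: "\<bar>f (x + 1) - f x\<bar> = 1" if "a \<le> x" "x < a + 2 * int m" for x
  proof -
    have "nat (x + 1 - a) = Suc (nat (x - a))" "nat (x - a) < length d"
      using that len by auto
    then show ?thesis by (simp add: f_def height_Suc)
  qed
  show ?thesis
  proof
    show "dyck_function a (a + 2 * int m) f"
      using odd d step by (auto simp: dyck_function_def f_def bpe_iff nat_mult_distrib)
    show "T = graph_on a (a + 2 * int m) f"
    proof (rule set_eqI, clarify)
      fix x y
      have "(x, y) \<in> T \<longleftrightarrow> (\<exists>k\<le>2 * m. x = a + int k \<and> y = b + height d k)"
        by (auto simp: T)
      also have "\<dots> \<longleftrightarrow> a \<le> x \<and> x \<le> a + 2 * int m \<and> y = f x"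
      proof
        assume "a \<le> x \<and> x \<le> a + 2 * int m \<and> y = f x"
        then show "\<exists>k\<le>2 * m. x = a + int k \<and> y = b + height d k"
          by (intro exI[of _ "nat (x - a)"]) (auto simp: f_def)
      qed (auto simp: f_def)
      finally show "(x, y) \<in> T \<longleftrightarrow> (x, y) \<in> graph_on a (a + 2 * int m) f"
        by (simp add: mem_graph_on)
    qed
  qed
qed

text \<open>The word of the tile records the ascents and descents of \<open>f\<close>; parity forces its length to be
  even.\<close>

lemma graph_imp_dyck_tile:
  assumes "dyck_function a c f"
  shows "dyck_tile (graph_on a c f)"
proof -
  have ac: "a \<le> c" and odd: "odd (a + f a)" and fc: "f c = f a"
    and above: "\<And>x. a \<le> x \<Longrightarrow> x \<le> c \<Longrightarrow> f a \<le> f x"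
    and step: "\<And>x. a \<le> x \<Longrightarrow> x < c \<Longrightarrow> \<bar>f (x + 1) - f x\<bar> = 1"
    using assms by (auto simp: dyck_function_def)
  define N where "N = nat (c - a)"
  define d where "d = map (\<lambda>i. if f (a + int i + 1) > f (a + int i) then LP else RP) [0..<N]"
  have len: "length d = N" by (simp add: d_def)
  have h: "height d i = f (a + int i) - f a" if "i \<le> N" for i
    using that
  proof (induction i)
    case (Suc i)
    have "height d (Suc i) = height d i + (if f (a + int i + 1) > f (a + int i) then 1 else -1)"
      using Suc.prems len by (simp add: height_Suc d_def)
    moreover have "\<bar>f (a + int i + 1) - f (a + int i)\<bar> = 1"
      using Suc.prems by (intro step) (auto simp: N_def)
    ultimately show ?case using Suc by (auto simp: add.assoc add.commute[of 1])
  qed simp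
  have N: "a + int N = c" using ac by (simp add: N_def)
  have "height d N = 0" using h[of N] N fc by simp
  then have "even N" using even_height[of N d] len by simp
  then obtain m where m: "N = 2 * m" by blast
  have "d \<in> bpe m"
    using h above N \<open>height d N = 0\<close> len by (auto simp: bpe_iff m)
  moreover have "graph_on a c f = {(a + int k, f a + height d k) | k. k \<le> 2 * m}"
  proof (rule set_eqI, clarify)
    fix x y
    have "(\<exists>k\<le>N. x = a + int k \<and> y = f a + height d k) \<longleftrightarrow> (\<exists>k\<le>N. x = a + int k \<and> y = f (a + int k))"
      using h by auto
    also have "\<dots> \<longleftrightarrow> a \<le> x \<and> x \<le> c \<and> y = f x"
    proof
      assume "a \<le> x \<and> x \<le> c \<and> y = f x"
      then show "\<exists>k\<le>N. x = a + int k \<and> y = f (a + int k)"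
        by (intro exI[of _ "nat (x - a)"]) (auto simp: N_def)
    qed (use N in auto)
    finally show "(x, y) \<in> graph_on a c f \<longleftrightarrow>
        (x, y) \<in> {(a + int k, f a + height d k) | k. k \<le> 2 * m}"
      by (auto simp: mem_graph_on m)
  qed
  ultimately show ?thesis using odd unfolding dyck_tile_def by blast
qed

lemma dyck_tile_iff: "dyck_tile T \<longleftrightarrow> (\<exists>a c f. dyck_function a c f \<and> T = graph_on a c f)"
  using dyck_tile_imp_graph graph_imp_dyck_tile by metis

lemma dyck_tile_single: "odd (x + y) \<Longrightarrow> dyck_tile {(x, y)}"
  unfolding dyck_tile_iff
  by (intro exI[of _ x] exI[of _ "\<lambda>_. y"]) (auto simp: dyck_function_def graph_on_def)

section \<open>Collapsing three adjacent columns\<close>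

text \<open>The columns \<open>K\<close>, \<open>K + 1\<close>, \<open>K + 2\<close> become the single column \<open>K\<close>, the middle one being lowered
  by 1. Hence the fibre over a box \<open>(K, y)\<close> is the small peak
  \<open>{(K, y), (K + 1, y + 1), (K + 2, y)}\<close>, and all other fibres are single boxes. Tilings of the
  smaller shape are lifted by taking preimages, which respect unions and disjointness for free.\<close>

definition collapse_column :: "int \<Rightarrow> int \<Rightarrow> int" where
  "collapse_column K x = (if x \<le> K then x else if x = K + 1 then K else x - 2)"

definition collapse :: "int \<Rightarrow> box \<Rightarrow> box" where
  "collapse K p = (collapse_column K (fst p), if fst p = K + 1 then snd p - 1 else snd p)"

text \<open>A section of \<^const>\<open>collapse_column\<close> that avoids the columns \<open>K + 1\<close> and \<open>K + 2\<close>.\<close>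

definition expand_column :: "int \<Rightarrow> int \<Rightarrow> int" where
  "expand_column K x = (if x \<le> K then x else x + 2)"

lemma collapse_expand_column [simp]: "collapse_column K (expand_column K x) = x"
  by (auto simp: collapse_column_def expand_column_def)

lemma collapse_expand [simp]: "collapse K (expand_column K x, y) = (x, y)"
  by (auto simp: collapse_def collapse_column_def expand_column_def)

lemma surj_collapse: "surj (collapse K)"
  by (metis collapse_expand surj_def surj_pair)

lemma surj_collapse_column: "surj (collapse_column K)"
  by (metis collapse_expand_column surj_def)

text \<open>Taking the preimage inserts a peak into the Dyck path of a tile that meets column \<open>K\<close>, and
  otherwise translates the tile or leaves it alone.\<close>

lemma dyck_tile_vimage:
  assumes "dyck_tile T"
  shows "dyck_tile (collapse K -` T)"
proof -
  obtain a c f where f: "dyck_function a c f" and T: "T = graph_on a c f"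
    using assms by (rule dyck_tile_imp_graph)
  define a' where "a' = (if a \<le> K then a else a + 2)"
  define c' where "c' = (if c < K then c else c + 2)"
  define f' where "f' x = f (collapse_column K x) + (if x = K + 1 then 1 else 0)" for x
  have "collapse K -` T = graph_on a' c' f'"
    unfolding T
    by (auto simp: mem_graph_on collapse_def collapse_column_def a'_def c'_def f'_def split: if_splits)
  moreover have "dyck_function a' c' f'"
    unfolding dyck_function_def
  proof (intro conjI ballI)
    fix x assume x: "x \<in> {a'..<c'}"
    have step: "\<bar>f (y + 1) - f y\<bar> = 1" if "a \<le> y" "y < c" for y
      using f that by (auto simp: dyck_function_def)
    consider "x < K" | "x = K" | "x = K + 1" | "K + 2 \<le> x" by linarith
    then show "\<bar>f' (x + 1) - f' x\<bar> = 1"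
    proof cases
      case 1
      then show ?thesis using x step[of x] by (auto simp: f'_def collapse_column_def a'_def c'_def split: if_splits)
    next
      case 4
      then show ?thesis using x step[of "x - 2"]
        by (auto simp: f'_def collapse_column_def a'_def c'_def algebra_simps split: if_splits)
    qed (auto simp: f'_def collapse_column_def)
  next
    show "a' \<le> c'" using f by (auto simp: a'_def c'_def dyck_function_def)
  next
    show "odd (a' + f' a')" using f by (auto simp: a'_def f'_def collapse_column_def dyck_function_def)
  next
    show "f' c' = f' a'" using f by (auto simp: a'_def c'_def f'_def collapse_column_def dyck_function_def)
  next
    fix x assume "x \<in> {a'..c'}"
    then have "collapse_column K x \<in> {a..c}" by (auto simp: collapse_column_def a'_def c'_def split: if_splits)
    then have "f a \<le> f (collapse_column K x)" using f by (auto simp: dyck_function_def)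
    moreover have "f' a' = f a" by (auto simp: a'_def f'_def collapse_column_def)
    moreover have "f (collapse_column K x) \<le> f' x" by (simp add: f'_def)
    ultimately show "f' a' \<le> f' x" by linarith
  qed
  ultimately show ?thesis by (metis graph_imp_dyck_tile)
qed



text \<open>Conversely, a Dyck tile that is a union of fibres has a peak at \<open>K + 1\<close> as soon as it meets one
  of the three columns, and removing this peak leaves a Dyck path.\<close>

lemma dyck_tile_collapse:
  assumes "dyck_tile (collapse K -` T)"
  shows "dyck_tile T"
proof -
  obtain a c f where f: "dyck_function a c f" and T: "collapse K -` T = graph_on a c f"
    using assms by (rule dyck_tile_imp_graph)
  then have ac: "a \<le> c" by (simp add: dyck_function_def)
  have sat: "(x', y') \<in> graph_on a c f"
    if "(x, y) \<in> graph_on a c f" "collapse K (x', y') = collapse K (x, y)" for x y x' y'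
    using that by (metis T vimage_eq)
  have memT: "(x, y) \<in> T \<longleftrightarrow> a \<le> expand_column K x \<and> expand_column K x \<le> c \<and> y = f (expand_column K x)" for x y
  proof -
    have "(x, y) \<in> T \<longleftrightarrow> (expand_column K x, y) \<in> collapse K -` T" by simp
    then show ?thesis by (simp add: T mem_graph_on)
  qed
  \<comment> \<open>The tile avoids the three columns or follows a fibre through all of them.\<close>
  have "c < K \<or> K + 2 < a \<or> a \<le> K \<and> K + 2 \<le> c \<and> f (K + 1) = f K + 1 \<and> f (K + 2) = f K"
  proof (rule ccontr)
    assume neg: "\<not> ?thesis"
    have "\<exists>x\<in>{K, K + 1, K + 2}. a \<le> x \<and> x \<le> c"
      using neg ac by (cases "K < a"; cases "a = K + 1") auto
    then obtain x where x: "x \<in> {K, K + 1, K + 2}" "(x, f x) \<in> graph_on a c f"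
      by (auto simp: mem_graph_on)
    define y where "y = (if x = K + 1 then f x - 1 else f x)"
    have "collapse K (x, f x) = (K, y)" using x(1) by (auto simp: collapse_def collapse_column_def y_def)
    moreover have "collapse K (K, y) = (K, y)" "collapse K (K + 1, y + 1) = (K, y)"
      "collapse K (K + 2, y) = (K, y)"
      by (simp_all add: collapse_def collapse_column_def)
    ultimately have "(K, y) \<in> graph_on a c f" "(K + 1, y + 1) \<in> graph_on a c f"
      "(K + 2, y) \<in> graph_on a c f"
      using sat[OF x(2)] by simp_all
    then show False using neg by (auto simp: mem_graph_on)
  qed
  with ac have ends: "a \<le> expand_column K x \<and> expand_column K x \<le> c \<longleftrightarrow> collapse_column K a \<le> x \<and> x \<le> collapse_column K c"
    and ea: "expand_column K (collapse_column K a) = a" and ec: "f (expand_column K (collapse_column K c)) = f c"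
    and step: "collapse_column K a \<le> x \<Longrightarrow> x < collapse_column K c \<Longrightarrow> expand_column K x + 1 = expand_column K (x + 1) \<or>
        f (expand_column K x) = f (expand_column K x + 2) \<and> expand_column K x + 2 + 1 = expand_column K (x + 1) \<and> a \<le> expand_column K x + 2" for x
    unfolding expand_column_def collapse_column_def by (smt (verit))+
  have "T = graph_on (collapse_column K a) (collapse_column K c) (\<lambda>x. f (expand_column K x))"
    by (auto simp: memT mem_graph_on ends)
  moreover have "dyck_function (collapse_column K a) (collapse_column K c) (\<lambda>x. f (expand_column K x))"
    unfolding dyck_function_def
  proof (intro conjI ballI)
    show "collapse_column K a \<le> collapse_column K c" using f by (auto simp: dyck_function_def collapse_column_def)
    show "f (expand_column K (collapse_column K c)) = f (expand_column K (collapse_column K a))"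
      using f by (simp add: ea ec dyck_function_def)
    have "even (a - collapse_column K a)" using ea by (auto simp: collapse_column_def expand_column_def split: if_splits)
    then show "odd (collapse_column K a + f (expand_column K (collapse_column K a)))"
      using f by (simp add: ea dyck_function_def)
    fix x assume "x \<in> {collapse_column K a..collapse_column K c}"
    then show "f (expand_column K (collapse_column K a)) \<le> f (expand_column K x)"
      using f ends[of x] by (simp add: ea dyck_function_def)
  next
    fix x assume x: "x \<in> {collapse_column K a..<collapse_column K c}"
    have "a \<le> expand_column K x" "expand_column K (x + 1) \<le> c" using ends[of x] ends[of "x + 1"] x by auto
    moreover have "\<bar>f (y + 1) - f y\<bar> = 1" if "a \<le> y" "y < c" for y
      using f that by (simp add: dyck_function_def)
    ultimately show "\<bar>f (expand_column K (x + 1)) - f (expand_column K x)\<bar> = 1"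
      using step[of x] x by (smt (verit) atLeastLessThan_iff)
  qed
  ultimately show ?thesis by (metis graph_imp_dyck_tile)
qed

lemma dyck_tile_vimage_iff: "dyck_tile (collapse K -` T) \<longleftrightarrow> dyck_tile T"
  using dyck_tile_vimage dyck_tile_collapse by blast

lemma extent_vimage: "extent (collapse K -` T) = collapse_column K -` extent T"
proof (rule set_eqI)
  fix x
  show "x \<in> extent (collapse K -` T) \<longleftrightarrow> x \<in> collapse_column K -` extent T"
  proof
    assume "x \<in> extent (collapse K -` T)"
    then show "x \<in> collapse_column K -` extent T" by (force simp: extent_def collapse_def)
  next
    assume "x \<in> collapse_column K -` extent T"
    then obtain y where "(collapse_column K x, y) \<in> T" by (auto simp: extent_def)
    then have "collapse K (x, if x = K + 1 then y + 1 else y) \<in> T"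
      by (auto simp: collapse_def)
    then show "x \<in> extent (collapse K -` T)"
      unfolding extent_def by (metis fst_conv image_eqI vimageI2)
  qed
qed

lemma vimage_collapse_eq_iff [simp]: "collapse K -` T = collapse K -` T' \<longleftrightarrow> T = T'"
  by (metis surj_collapse surj_image_vimage_eq)

lemma covers_vimage_iff: "covers (collapse K -` T) (collapse K -` T') \<longleftrightarrow> covers T T'"
proof -
  have "(\<exists>i j j'. (i, j) \<in> collapse K -` T \<and> (i, j') \<in> collapse K -` T' \<and> j' < j) \<longleftrightarrow>
        (\<exists>i j j'. (i, j) \<in> T \<and> (i, j') \<in> T' \<and> j' < j)" (is "?A \<longleftrightarrow> ?B")
  proof
    assume ?A
    then obtain i j j' where *: "collapse K (i, j) \<in> T" "collapse K (i, j') \<in> T'" "j' < j" by auto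
    define e where "e = (if i = K + 1 then 1 else 0 :: int)"
    have "(collapse_column K i, j - e) \<in> T" "(collapse_column K i, j' - e) \<in> T'" "j' - e < j - e"
      using * by (auto simp: collapse_def e_def split: if_splits)
    then show ?B by blast
  next
    assume ?B
    then obtain i j j' where "(i, j) \<in> T" "(i, j') \<in> T'" "j' < j" by auto
    then show ?A by (intro exI[of _ "expand_column K i"] exI[of _ j] exI[of _ j']) simp
  qed
  then show ?thesis by (simp add: covers_def)
qed

lemma cover_inclusive_vimage_iff:
  "cover_inclusive ((-`) (collapse K) ` D) \<longleftrightarrow> cover_inclusive D"
proof -
  have "extent (collapse K -` T) \<subseteq> extent (collapse K -` T') \<longleftrightarrow> extent T \<subseteq> extent T'" for T T'
    unfolding extent_vimage by (metis surj_collapse_column surj_image_vimage_eq image_mono vimage_mono)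
  then show ?thesis by (simp add: cover_inclusive_def covers_vimage_iff)
qed

lemma partition_on_vimage_iff:
  "partition_on (collapse K -` A) ((-`) (collapse K) ` D) \<longleftrightarrow> partition_on A D"
proof -
  have empty: "collapse K -` T = {} \<longleftrightarrow> T = {}" for T
    using vimage_collapse_eq_iff[of K T "{}"] by (simp only: vimage_empty)
  have "\<Union> ((-`) (collapse K) ` D) = collapse K -` \<Union> D" by blast
  then have 1: "\<Union> ((-`) (collapse K) ` D) = collapse K -` A \<longleftrightarrow> \<Union> D = A"
    by (simp only: vimage_collapse_eq_iff)
  have 2: "collapse K -` T \<inter> collapse K -` T' = {} \<longleftrightarrow> T \<inter> T' = {}" for T T'
    using empty[of "T \<inter> T'"] by (simp only: vimage_Int)
  have "{} \<in> (-`) (collapse K) ` D \<longleftrightarrow> (\<exists>T\<in>D. collapse K -` T = {})"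
    unfolding image_iff by (rule bex_cong[OF refl]) (rule eq_commute)
  then have 3: "{} \<in> (-`) (collapse K) ` D \<longleftrightarrow> {} \<in> D"
    by (simp only: empty) blast
  show ?thesis
    unfolding partition_on_def disjoint_def ball_simps 1 2 3 vimage_collapse_eq_iff by (rule refl)
qed

section \<open>Cover-inclusive tilings below a peak\<close>

definition ci_tilings :: "box set \<Rightarrow> box set set set" where
  "ci_tilings A = {D. partition_on A D \<and> (\<forall>T\<in>D. dyck_tile T) \<and> cover_inclusive D}"

lemma finite_ci_tilings: "finite A \<Longrightarrow> finite (ci_tilings A)"
  by (rule finite_subset[of _ "Pow (Pow A)"]) (auto simp: ci_tilings_def partition_on_def)

lemma ci_tilings_empty [simp]: "ci_tilings {} = {{}}"
  by (auto simp: ci_tilings_def partition_on_def cover_inclusive_def)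

text \<open>A single box on top of its column can be added to any cover-inclusive tiling: nothing covers
  it, and every tile that it covers contains its column.\<close>

lemma ci_tilings_insert_top:
  assumes A: "(x, h) \<in> A" and top: "\<And>y. (x, y) \<in> A \<Longrightarrow> y \<le> h" and odd: "odd (x + h)"
  shows "bij_betw (insert {(x, h)}) (ci_tilings (A - {(x, h)})) {D \<in> ci_tilings A. {(x, h)} \<in> D}"
proof -
  have ci: "cover_inclusive (insert {(x, h)} D) \<longleftrightarrow> cover_inclusive D"
    if "\<Union> D = A - {(x, h)}" for D
  proof -
    have "extent {(x, h)} \<subseteq> extent T" if "covers {(x, h)} T" for T
      using that by (force simp: covers_def extent_def)
    moreover have "\<not> covers T {(x, h)}" if "T \<in> D" for T
    proof
      assume "covers T {(x, h)}"
      then obtain j where "(x, j) \<in> T" "h < j" by (auto simp: covers_def)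
      moreover from this have "(x, j) \<in> A" using \<open>\<Union> D = _\<close> that by blast
      ultimately show False using top[of j] by simp
    qed
    ultimately show ?thesis unfolding cover_inclusive_def by (metis insert_iff order_refl)
  qed
  have part: "partition_on A (insert {(x, h)} D) \<longleftrightarrow> partition_on (A - {(x, h)}) D"
    if "\<Union> D \<subseteq> A - {(x, h)}" for D
    using that A by (subst partition_on_insert) (auto simp: disjnt_def)
  show ?thesis
  proof (rule bij_betwI[where g = "\<lambda>D. D - {{(x, h)}}"])
    show "insert {(x, h)} \<in> ci_tilings (A - {(x, h)}) \<rightarrow> {D \<in> ci_tilings A. {(x, h)} \<in> D}"
    proof
      fix D assume "D \<in> ci_tilings (A - {(x, h)})"
      moreover from this have "\<Union> D = A - {(x, h)}" by (simp add: ci_tilings_def partition_on_def)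
      ultimately show "insert {(x, h)} D \<in> {D \<in> ci_tilings A. {(x, h)} \<in> D}"
        using ci part odd by (simp add: ci_tilings_def dyck_tile_single)
    qed
    show "(\<lambda>D. D - {{(x, h)}}) \<in> {D \<in> ci_tilings A. {(x, h)} \<in> D} \<rightarrow> ci_tilings (A - {(x, h)})"
    proof
      fix D assume "D \<in> {D \<in> ci_tilings A. {(x, h)} \<in> D}"
      then have D: "D \<in> ci_tilings A" "insert {(x, h)} (D - {{(x, h)}}) = D"
        and mem: "{(x, h)} \<in> D" by auto
      have "T \<inter> {(x, h)} = {}" if "T \<in> D - {{(x, h)}}" for T
        using D(1) mem that unfolding ci_tilings_def partition_on_def by (blast dest: disjointD)
      moreover have "\<Union> D = A" using D(1) by (simp add: ci_tilings_def partition_on_def)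
      ultimately have "\<Union> (D - {{(x, h)}}) \<subseteq> A - {(x, h)}" by blast
      with part[of "D - {{(x, h)}}"] D have "partition_on (A - {(x, h)}) (D - {{(x, h)}})"
        by (simp add: ci_tilings_def)
      then show "D - {{(x, h)}} \<in> ci_tilings (A - {(x, h)})"
        using D by (auto simp: ci_tilings_def cover_inclusive_def)
    qed
    show "insert {(x, h)} D - {{(x, h)}} = D" if "D \<in> ci_tilings (A - {(x, h)})" for D
      using that by (auto simp: ci_tilings_def partition_on_def)
  qed auto
qed

text \<open>This is where cover-inclusiveness is used. Column \<open>K + 1\<close> of the shape rises one box above its
  two neighbours, as below a peak. If its top box \<open>(K + 1, h)\<close> is not a tile by itself, then its
  tile cannot start or end there, since it could only continue upwards; so it descends on both
  sides. A tile further down in this column is covered by the tile \<open>T'\<close> two boxes above, hence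
  extends over columns \<open>K\<close> and \<open>K + 2\<close> as well. It also descends on both sides, because \<open>T'\<close>
  occupies the neighbouring boxes above. The induction is on the distance from the top.\<close>

lemma ci_tilings_no_single:
  assumes D: "D \<in> ci_tilings A" and no: "{(K + 1, h)} \<notin> D"
    and mid: "\<And>y. (K + 1, y) \<in> A \<Longrightarrow> y = h \<or> (K + 1, y + 2) \<in> A \<and> y < h"
    and left: "(K, h + 1) \<notin> A" and right: "(K + 2, h + 1) \<notin> A"
    and T: "T \<in> D" "(K + 1, y) \<in> T"
  shows "(K, y - 1) \<in> T \<and> (K + 2, y - 1) \<in> T"
  using T
proof (induction "nat (h - y)" arbitrary: y T rule: less_induct)
  case less
  note T = \<open>T \<in> D\<close> \<open>(K + 1, y) \<in> T\<close>
  have A: "\<Union> D = A" and disj: "\<And>T T' p. T \<in> D \<Longrightarrow> T' \<in> D \<Longrightarrow> p \<in> T \<Longrightarrow> p \<in> T' \<Longrightarrow> T = T'"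
    and ci: "\<And>T T'. T \<in> D \<Longrightarrow> T' \<in> D \<Longrightarrow> covers T T' \<Longrightarrow> extent T \<subseteq> extent T'"
    using D unfolding ci_tilings_def partition_on_def disjoint_def cover_inclusive_def by blast+
  have "dyck_tile T" using D T by (auto simp: ci_tilings_def)
  then obtain a c f where f: "dyck_function a c f" and graph: "T = graph_on a c f"
    by (rule dyck_tile_imp_graph)
  have ac: "a \<le> K + 1" "K + 1 \<le> c" and fy: "f (K + 1) = y"
    using T(2) by (auto simp: graph mem_graph_on)
  have base: "f a \<le> f x" if "a \<le> x" "x \<le> c" for x using f that by (simp add: dyck_function_def)
  have step: "f (x + 1) = f x + 1 \<or> f (x + 1) = f x - 1" if "a \<le> x" "x < c" for x
    using f that unfolding dyck_function_def by (smt (verit) atLeastLessThan_iff)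
  have inA: "(x, f x) \<in> A" if "a \<le> x" "x \<le> c" for x
    using that T(1) A by (auto simp: graph mem_graph_on)
  have stepL: "f K = y - 1 \<or> f K = y + 1" if "a \<le> K" using step[of K] ac fy that by auto
  have stepR: "f (K + 2) = y - 1 \<or> f (K + 2) = y + 1" if "K + 2 \<le> c"
    using step[of "K + 1"] ac fy that by (auto simp: add.assoc)
  have "a \<le> K \<and> K + 2 \<le> c \<and> f K \<noteq> y + 1 \<and> f (K + 2) \<noteq> y + 1"
  proof (cases "y = h")
    case True
    have "f K \<noteq> y + 1" if "a \<le> K" using inA[of K] that left True ac by auto
    moreover have R: "f (K + 2) \<noteq> y + 1" if "K + 2 \<le> c" using inA[of "K + 2"] that right True ac by auto
    moreover have "T \<noteq> {(K + 1, h)}" using no T by auto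
    then have "\<not> (a = K + 1 \<and> c = K + 1)" using True fy by (auto simp: graph graph_on_def)
    moreover have "f a = f c" using f by (simp add: dyck_function_def)
    ultimately show ?thesis
      using base[of K] base[of "K + 2"] stepL stepR fy ac by (smt (verit))
  next
    case False
    then have up: "(K + 1, y + 2) \<in> A" "y < h" using mid T A by blast+
    then obtain T' where T': "T' \<in> D" "(K + 1, y + 2) \<in> T'" using A by blast
    then have *: "(K, y + 1) \<in> T'" "(K + 2, y + 1) \<in> T'"
      using less.hyps[of "y + 2" T'] up by (simp_all add: add.commute)
    have ne: "T' \<noteq> T" using T'(2) fy by (auto simp: graph mem_graph_on)
    then have "covers T' T" using T'(2) T(2) unfolding covers_def by force
    then have "extent T' \<subseteq> extent T" using ci T' T by blast
    then have "K \<in> extent T" "K + 2 \<in> extent T" using * by (force simp: extent_def)+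
    then have ends: "a \<le> K" "K + 2 \<le> c" by (auto simp: extent_def graph graph_on_def)
    have "(K, y + 1) \<notin> T" "(K + 2, y + 1) \<notin> T" using disj T T' * ne by blast+
    then show ?thesis using ends by (auto simp: graph mem_graph_on)
  qed
  then show ?case using stepL stepR by (auto simp: graph mem_graph_on)
qed

lemma ci_tilings_vimage_iff:
  "(-`) (collapse K) ` D \<in> ci_tilings (collapse K -` A) \<longleftrightarrow> D \<in> ci_tilings A"
  by (simp add: ci_tilings_def partition_on_vimage_iff cover_inclusive_vimage_iff dyck_tile_vimage_iff)

text \<open>Under the same assumption on the top box, the previous lemma says that every tile is a union of
  fibres of \<^const>\<open>collapse\<close>, so the tiling is lifted from the collapsed shape.
  The hypotheses describe column \<open>K\<close> of the collapsed shape: it has no gaps, and its top box, if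
  any, is at height \<open>h - 1\<close>.\<close>

lemma ci_tilings_vimage:
  assumes top: "\<And>y. (K, y) \<in> A \<Longrightarrow> y < h \<and> even (h - 1 - y)"
    and conv: "\<And>y. (K, y) \<in> A \<Longrightarrow> y = h - 1 \<or> (K, y + 2) \<in> A"
  shows "bij_betw ((`) ((-`) (collapse K))) (ci_tilings A)
    {D \<in> ci_tilings (collapse K -` A). {(K + 1, h)} \<notin> D}"
proof (rule bij_betw_imageI)
  show "inj_on ((`) ((-`) (collapse K))) (ci_tilings A)"
    by (rule inj_on_image) (simp add: inj_on_def)
  show "(`) ((-`) (collapse K)) ` ci_tilings A = {D \<in> ci_tilings (collapse K -` A). {(K + 1, h)} \<notin> D}"
  proof (intro equalityI subsetI)
    fix D' assume "D' \<in> (`) ((-`) (collapse K)) ` ci_tilings A"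
    then obtain D where D: "D \<in> ci_tilings A" "D' = (-`) (collapse K) ` D" by blast
    have single: "collapse K -` T \<noteq> {(K + 1, h)}" for T
    proof
      assume *: "collapse K -` T = {(K + 1, h)}"
      then have "collapse K (K + 1, h) \<in> T" by blast
      then have "(K, h - 1) \<in> collapse K -` T" by (simp add: collapse_def collapse_column_def)
      then show False by (simp add: *)
    qed
    have "{(K + 1, h)} \<notin> D'"
    proof
      assume "{(K + 1, h)} \<in> D'"
      then obtain T where "{(K + 1, h)} = collapse K -` T" unfolding D(2) by (rule imageE)
      then show False using single[of T] by simp
    qed
    then show "D' \<in> {D \<in> ci_tilings (collapse K -` A). {(K + 1, h)} \<notin> D}"
      using D(1) ci_tilings_vimage_iff[of K D A] by (simp add: D(2))
  next
    fix D assume "D \<in> {D \<in> ci_tilings (collapse K -` A). {(K + 1, h)} \<notin> D}"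
    then have D: "D \<in> ci_tilings (collapse K -` A)" and no: "{(K + 1, h)} \<notin> D" by auto
    have UD: "\<Union> D = collapse K -` A" and disj: "\<And>T T' p. T \<in> D \<Longrightarrow> T' \<in> D \<Longrightarrow> p \<in> T \<Longrightarrow> p \<in> T' \<Longrightarrow> T = T'"
      using D unfolding ci_tilings_def partition_on_def disjoint_def by blast+
    have down: "(K, y - 1) \<in> T \<and> (K + 2, y - 1) \<in> T" if "T \<in> D" "(K + 1, y) \<in> T" for T y
    proof (rule ci_tilings_no_single[OF D no _ _ _ that])
      show "(K, h + 1) \<notin> collapse K -` A" "(K + 2, h + 1) \<notin> collapse K -` A"
        using top[of "h + 1"] by (auto simp: collapse_def collapse_column_def)
      fix y assume "(K + 1, y) \<in> collapse K -` A"
      then have "(K, y - 1) \<in> A" by (simp add: collapse_def collapse_column_def)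
      then show "y = h \<or> (K + 1, y + 2) \<in> collapse K -` A \<and> y < h"
        using conv[of "y - 1"] top[of "y - 1"] by (auto simp: collapse_def collapse_column_def algebra_simps)
    qed
    have up: "(K + 1, y + 1) \<in> T" if "T \<in> D" "(x, y) \<in> T" "x = K \<or> x = K + 2" for T x y
    proof -
      have "(x, y) \<in> collapse K -` A" using that UD by blast
      then have "(K + 1, y + 1) \<in> \<Union> D"
        using that(3) unfolding UD by (auto simp: collapse_def collapse_column_def)
      then obtain T' where T': "T' \<in> D" "(K + 1, y + 1) \<in> T'" by blast
      then have "(x, y) \<in> T'" using down[OF T'] that(3) by auto
      then show ?thesis using disj that T' by blast
    qed
    \<comment> \<open>A tile containing one box of a fibre contains the middle box, by \<open>up\<close>, and then the whole fibre, by \<open>down\<close>.\<close>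
    have sat: "collapse K -` collapse K ` T = T" if T: "T \<in> D" for T
    proof
      have "q \<in> T" if "p \<in> T" "collapse K q = collapse K p" for p q
      proof -
        obtain x y u v where pq: "p = (x, y)" "q = (u, v)" by fastforce
        have fibre: "s = K \<and> t = z \<or> s = K + 1 \<and> t = z + 1 \<or> s = K + 2 \<and> t = z"
          if "collapse K (s, t) = (K, z)" for s t z
          using that unfolding collapse_def collapse_column_def by (auto split: if_splits)
        have mid: "(K + 1, z + 1) \<in> T"
          if "(s, t) \<in> T" "collapse K (s, t) = (K, z)" for s t z
          using fibre[OF that(2)] up[OF T that(1)] that(1) by blast
        have all: "(u, v) \<in> T" if "(K + 1, z + 1) \<in> T" "collapse K (u, v) = (K, z)" for z
          using fibre[OF that(2)] down[OF T that(1)] that(1) by (simp only: add_diff_cancel) blast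
        show ?thesis
        proof (cases "collapse_column K x = K")
          case True
          then obtain z where "collapse K (x, y) = (K, z)" by (auto simp: collapse_def)
          then have "(K + 1, z + 1) \<in> T" "collapse K (u, v) = (K, z)"
            using mid[of x y z] that unfolding pq by simp_all
          then show ?thesis unfolding pq(2) by (rule all)
        next
          case False
          then have "(u, v) = (x, y)"
            using that pq by (auto simp: collapse_def collapse_column_def split: if_splits)
          then show ?thesis using that pq by simp
        qed
      qed
      then show "collapse K -` collapse K ` T \<subseteq> T" by blast
    qed blast
    define D' where "D' = (`) (collapse K) ` D"
    have img: "(-`) (collapse K) ` D' = D"
      unfolding D'_def image_image using sat by simp
    have "D' \<in> ci_tilings A"
      using D ci_tilings_vimage_iff[of K D' A] by (simp only: img)
    then have "(-`) (collapse K) ` D' \<in> (`) ((-`) (collapse K)) ` ci_tilings A"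
      by (rule imageI)
    then show "D \<in> (`) ((-`) (collapse K)) ` ci_tilings A"
      by (simp only: img)
  qed
qed

text \<open>All fibres have 1 or 3 elements, so the sign in the theorem is unaffected by a collapse.\<close>

lemma even_card_collapse:
  assumes "finite A"
  shows "finite (collapse K -` A) \<and> (even (card (collapse K -` A)) \<longleftrightarrow> even (card A))"
  using assms
proof (induction A)
  case (insert p A)
  obtain x y where p: "p = (x, y)" by fastforce
  have "finite (collapse K -` {p}) \<and> odd (card (collapse K -` {p}))"
  proof (cases "x = K")
    case True
    then have "collapse K -` {p} = {(K, y), (K + 1, y + 1), (K + 2, y)}"
      unfolding p by (auto simp: collapse_def collapse_column_def split: if_splits)
    then show ?thesis by simp
  next
    case False
    then have "collapse K -` {p} = {(expand_column K x, y)}"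
      unfolding p by (auto simp: collapse_def collapse_column_def expand_column_def split: if_splits)
    then show ?thesis by simp
  qed
  moreover have "collapse K -` insert p A = collapse K -` {p} \<union> collapse K -` A"
    "collapse K -` {p} \<inter> collapse K -` A = {}" using insert by auto
  ultimately show ?case using insert by (simp add: card_Un_disjoint)
qed simp

section \<open>The recurrence for signed counts\<close>

lemma mem_skew_shape:
  "(x, y) \<in> skew_shape n lam mu \<longleftrightarrow> 0 \<le> x \<and> x \<le> 2 * int n \<and> odd (x + y) \<and>
     height lam (nat x) < y \<and> y < height mu (nat x)"
proof
  assume "0 \<le> x \<and> x \<le> 2 * int n \<and> odd (x + y) \<and> height lam (nat x) < y \<and> y < height mu (nat x)"
  then show "(x, y) \<in> skew_shape n lam mu"
    unfolding skew_shape_def by (intro CollectI exI[of _ "nat x"] exI[of _ y]) auto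
qed (auto simp: skew_shape_def)

lemma finite_skew_shape [simp]: "finite (skew_shape n lam mu)"
proof -
  have "skew_shape n lam mu \<subseteq>
    (\<Union>i\<le>2 * n. Pair (int i) ` {height lam i..height mu i})"
    by (auto simp: skew_shape_def)
  then show ?thesis by (rule finite_subset) auto
qed

definition below :: "nat \<Rightarrow> paren list \<Rightarrow> paren list \<Rightarrow> bool" where
  "below n lam mu \<longleftrightarrow> (\<forall>i\<le>2 * n. height lam i \<le> height mu i)"

text \<open>The claimed inverse, extended by 0 to pairs in which \<open>lam\<close> is not below \<open>mu\<close>; the recurrence
  then also holds when the peak of \<open>mu\<close> touches \<open>lam\<close>.\<close>

definition signed_count :: "nat \<Rightarrow> paren list \<Rightarrow> paren list \<Rightarrow> int" where
  "signed_count n lam mu = (if below n lam mu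
     then (-1) ^ card (skew_shape n lam mu) * int (card (ci_tilings (skew_shape n lam mu))) else 0)"

lemma below_peak_iff:
  assumes "k \<le> length l" "length l = 2 * n" "length w = 2 * n"
  shows "below (Suc n) (peak k l) (peak k w) \<longleftrightarrow> below n l w"
proof
  assume B: "below (Suc n) (peak k l) (peak k w)"
  show "below n l w"
    unfolding below_def
  proof (intro allI impI)
    fix i assume "i \<le> 2 * n"
    then show "height l i \<le> height w i"
      using B[unfolded below_def, rule_format, of "if i \<le> k then i else i + 2"] assms
      by (cases "i \<le> k") (auto simp: height_peak)
  qed
next
  assume B: "below n l w"
  show "below (Suc n) (peak k l) (peak k w)"
    unfolding below_def
  proof (intro allI impI)
    fix i assume i: "i \<le> 2 * Suc n"
    have "height l (i - 2) \<le> height w (i - 2)" "height l k \<le> height w k"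
      "i \<le> k \<Longrightarrow> height l i \<le> height w i"
      using B assms i by (auto simp: below_def)
    then show "height (peak k l) i \<le> height (peak k w) i"
      using assms by (simp add: height_peak)
  qed
qed

lemma below_valley_iff:
  assumes "k \<le> length w" "length w = 2 * n"
  shows "below (Suc n) lam (valley k w) \<longleftrightarrow>
    below (Suc n) lam (peak k w) \<and> height lam (Suc k) \<le> height w k - 1"
proof -
  have "height (valley k w) i = (if i = Suc k then height w k - 1 else height (peak k w) i)" for i
    using assms by (simp add: height_peak height_valley)
  moreover have "height (peak k w) (Suc k) = height w k + 1"
    using assms by (simp add: height_peak)
  moreover have "Suc k \<le> 2 * Suc n" using assms by simp
  ultimately show ?thesis unfolding below_def by (smt (verit))
qed

lemma skew_shape_peak:
  assumes "k \<le> length l" "length l = 2 * n" "length w = 2 * n"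
  shows "skew_shape (Suc n) (peak k l) (peak k w) = collapse (int k) -` skew_shape n l w"
proof (rule set_eqI, clarify)
  fix x y
  consider "x < 0" | "0 \<le> x" "x \<le> int k" | "x = int k + 1" | "int k + 2 \<le> x" by linarith
  then show "(x, y) \<in> skew_shape (Suc n) (peak k l) (peak k w) \<longleftrightarrow>
    (x, y) \<in> collapse (int k) -` skew_shape n l w"
  proof cases
    case 3
    then have "nat x = k + 1" by simp
    with 3 show ?thesis using assms
      by (auto simp: mem_skew_shape collapse_def collapse_column_def height_peak)
  next
    case 4
    then have "nat (x - 2) = nat x - 2" "\<not> nat x \<le> k" "nat x \<noteq> k + 1" by auto
    then show ?thesis using 4 assms
      by (auto simp: mem_skew_shape collapse_def collapse_column_def height_peak)
  qed (use assms in \<open>auto simp: mem_skew_shape collapse_def collapse_column_def height_peak\<close>)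
qed

lemma skew_shape_valley:
  assumes "k \<le> length w" "length w = 2 * n"
  shows "skew_shape (Suc n) lam (valley k w) =
    skew_shape (Suc n) lam (peak k w) - {(int k + 1, height w k)}"
proof (rule set_eqI, clarify)
  fix x y
  have ev: "even (height w k + int k)" using even_height assms by simp
  show "(x, y) \<in> skew_shape (Suc n) lam (valley k w) \<longleftrightarrow>
    (x, y) \<in> skew_shape (Suc n) lam (peak k w) - {(int k + 1, height w k)}"
  proof (cases "x = int k + 1")
    case True
    then have "nat x = k + 1" by simp
    moreover have "odd (x + y) \<Longrightarrow> y < height w k + 1 \<Longrightarrow> y \<noteq> height w k \<Longrightarrow> y < height w k - 1"
      using ev True by (cases "y = height w k - 1") auto
    ultimately show ?thesis using assms True
      by (auto simp: mem_skew_shape height_peak height_valley)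
  next
    case False
    then have "0 \<le> x \<Longrightarrow> nat x \<noteq> k + 1" by auto
    then show ?thesis using assms False
      by (auto simp: mem_skew_shape height_peak height_valley)
  qed
qed

lemma peak_contract:
  assumes "Suc k < length lam" "lam ! k = LP" "lam ! Suc k = RP"
  shows "lam = peak k (contract k lam)"
proof -
  have "drop k lam = LP # RP # drop (Suc (Suc k)) lam"
    using assms Cons_nth_drop_Suc[of k lam] Cons_nth_drop_Suc[of "Suc k" lam] by simp
  then show ?thesis
    using assms append_take_drop_id[of k lam] by (simp add: peak_def contract_def)
qed
 
lemma contract_peak [simp]: "k \<le> length l \<Longrightarrow> contract k (peak k l) = l"
  by (simp add: peak_def contract_def)

text \<open>If the top box under the peak of the upper path is not a tile, then the lower path has a peak at
  the same place: either its column is empty and the paths touch at the top, or the tile through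
  the lowest box of this column descends on both sides and the lower path stays below it.\<close>

lemma no_single_imp_peak:
  assumes lam: "length lam = 2 * Suc n" and w: "length w = 2 * n" and k: "k \<le> 2 * n"
    and below: "below (Suc n) lam (peak k w)"
    and D: "D \<in> ci_tilings (skew_shape (Suc n) lam (peak k w))"
    and no: "{(int k + 1, height w k)} \<notin> D"
  shows "lam = peak k (contract k lam)"
proof -
  define A where "A = skew_shape (Suc n) lam (peak k w)"
  define h where "h = height w k"
  have hp: "height (peak k w) k = h" "height (peak k w) (k + 1) = h + 1" "height (peak k w) (k + 2) = h"
    using k w by (simp_all add: height_peak h_def)
  have nats: "nat (int k) = k" "nat (int k + 1) = k + 1" "nat (int k + 2) = k + 2" by auto
  have ev: "even (h + int k)" using even_height[of k w] k w by (simp add: h_def)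
  have "height lam k < height lam (k + 1) \<and> height lam (k + 2) < height lam (k + 1)"
  proof (cases "height lam (k + 1) < h + 1")
    case True
    define y where "y = height lam (k + 1) + 1"
    have "even (height lam (k + 1) + int (k + 1))" using even_height[of "k + 1" lam] k lam by simp
    moreover from this have "height lam (k + 1) \<noteq> h" using ev by auto
    then have "y < h + 1" using True by (simp add: y_def)
    ultimately have "(int k + 1, y) \<in> A"
      using k unfolding A_def mem_skew_shape nats hp by (simp add: y_def)
    moreover have UD: "\<Union> D = A"
      using D by (simp add: ci_tilings_def partition_on_def A_def)
    ultimately obtain T where T: "T \<in> D" "(int k + 1, y) \<in> T" by blast
    have "(int k, y - 1) \<in> T \<and> (int k + 2, y - 1) \<in> T"
    proof (rule ci_tilings_no_single[OF D[folded A_def] no[folded h_def] _ _ _ T])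
      show "(int k, h + 1) \<notin> A" "(int k + 2, h + 1) \<notin> A"
        unfolding A_def mem_skew_shape hp nats by simp_all
      fix y assume "(int k + 1, y) \<in> A"
      then have y: "odd (int k + 1 + y)" "height lam (k + 1) < y" "y < h + 1"
        unfolding A_def mem_skew_shape hp nats by simp_all
      have "y \<noteq> h - 1" using y(1) ev by auto
      then have "y = h \<or> y + 2 < h + 1" using y(3) by linarith
      then show "y = h \<or> (int k + 1, y + 2) \<in> A \<and> y < h"
        using y k unfolding A_def mem_skew_shape hp nats by auto
    qed
    then have "(int k, y - 1) \<in> A" "(int k + 2, y - 1) \<in> A" using T UD by blast+
    then show ?thesis unfolding A_def mem_skew_shape nats y_def by simp
  next
    case False
    moreover have "height lam k \<le> h" "height lam (k + 2) \<le> h"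
      using below[unfolded below_def, rule_format, of k] below[unfolded below_def, rule_format, of "k + 2"]
        k hp by auto
    ultimately show ?thesis by linarith
  qed
  moreover have "height lam (k + 1) = height lam k + (if lam ! k = LP then 1 else - 1)"
    "height lam (k + 2) = height lam (k + 1) + (if lam ! Suc k = LP then 1 else - 1)"
    using k lam height_Suc[of k lam] height_Suc[of "Suc k" lam] by simp_all
  ultimately have "lam ! k = LP" "lam ! Suc k = RP"
    by (auto simp: paren_neq_LP[symmetric] split: if_splits)
  then show ?thesis using k lam by (intro peak_contract) auto
qed

text \<open>Sort the tilings below \<open>peak k w\<close> by whether the top box under the peak is a tile. Those in
  which it is are, after removing this box, the tilings below \<open>valley k w\<close>; they have one box less,
  hence cancel in the sum. The others are the lifted tilings of the shape with both peaks removed,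
  and there are none unless the lower path has a peak there.\<close>

lemma signed_count_recurrence:
  assumes lam: "length lam = 2 * Suc n" and w: "length w = 2 * n" and k: "k \<le> 2 * n"
  shows "signed_count (Suc n) lam (peak k w) + signed_count (Suc n) lam (valley k w) =
    (if lam = peak k (contract k lam) then signed_count n (contract k lam) w else 0)"
proof (cases "below (Suc n) lam (peak k w)")
  case False
  then have "\<not> below (Suc n) lam (valley k w)" using below_valley_iff[of k w n lam] k w by simp
  moreover have "\<not> below n (contract k lam) w" if "lam = peak k (contract k lam)"
    using below_peak_iff[of k "contract k lam" n w] False that k w lam by (simp add: contract_def)
  ultimately show ?thesis using False by (simp add: signed_count_def)
next
  case True
  define A where "A = skew_shape (Suc n) lam (peak k w)"
  define h where "h = height w k"
  define p where "p = (int k + 1, h)"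
  define with_p where "with_p = {D \<in> ci_tilings A. {p} \<in> D}"
  define without_p where "without_p = {D \<in> ci_tilings A. {p} \<notin> D}"
  have kw: "k \<le> length w" using k w by simp
  have ev: "even (h + int k)" using even_height[of k w] kw by (simp add: h_def)
  have nats: "nat (int k + 1) = Suc k" by simp
  have hp: "height (peak k w) (Suc k) = h + 1" using kw by (simp add: height_peak h_def)
  have finA: "finite A" by (simp add: A_def)
  have "ci_tilings A = with_p \<union> without_p" "with_p \<inter> without_p = {}"
    by (auto simp: with_p_def without_p_def)
  then have card: "card (ci_tilings A) = card with_p + card without_p"
    using finite_ci_tilings[OF finA] by (metis card_Un_disjoint finite_Un)
  have valley: "signed_count (Suc n) lam (valley k w) = - ((-1) ^ card A * int (card with_p))"
  proof (cases "height lam (Suc k) \<le> h - 1")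
    case le: True
    have pA: "p \<in> A" using le k ev by (simp add: A_def p_def mem_skew_shape nats hp)
    have top: "\<And>y. (int k + 1, y) \<in> A \<Longrightarrow> y \<le> h" by (simp add: A_def mem_skew_shape nats hp)
    have "bij_betw (insert {p}) (ci_tilings (A - {p})) with_p"
      unfolding with_p_def p_def
    proof (rule ci_tilings_insert_top)
      show "(int k + 1, h) \<in> A" using pA by (simp add: p_def)
      show "odd (int k + 1 + h)" using ev by simp
    qed (rule top)
    then have "card with_p = card (ci_tilings (A - {p}))"
      by (rule bij_betw_same_card[symmetric])
    moreover have "card A = Suc (card (A - {p}))" by (rule card.remove[OF finA pA])
    moreover have "skew_shape (Suc n) lam (valley k w) = A - {p}"
      using skew_shape_valley[OF kw w] by (simp add: A_def p_def h_def)
    moreover have "below (Suc n) lam (valley k w)"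
      using below_valley_iff[OF kw w] True le by (simp add: h_def)
    ultimately show ?thesis by (simp add: signed_count_def)
  next
    case gt: False
    \<comment> \<open>The paths agree at \<open>k + 1\<close>, so there is no box under the peak.\<close>
    have "height lam (Suc k) \<noteq> h"
      using even_height[of "Suc k" lam] lam k ev by auto
    then have "p \<notin> A" using gt by (simp add: A_def p_def mem_skew_shape nats hp)
    then have "with_p = {}" by (auto simp: with_p_def ci_tilings_def partition_on_def)
    moreover have "\<not> below (Suc n) lam (valley k w)"
      using below_valley_iff[OF kw w] gt by (simp add: h_def)
    ultimately show ?thesis by (simp add: signed_count_def)
  qed
  have sum: "signed_count (Suc n) lam (peak k w) + signed_count (Suc n) lam (valley k w) =
    (-1) ^ card A * int (card without_p)"
    unfolding valley using True by (simp add: signed_count_def card A_def[symmetric] algebra_simps)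
  show ?thesis
  proof (cases "lam = peak k (contract k lam)")
    case peak: True
    define l where "l = contract k lam"
    define A' where "A' = skew_shape n l w"
    have l: "length l = 2 * n" "lam = peak k l" using peak lam k by (simp_all add: l_def contract_def)
    have A: "A = collapse (int k) -` A'"
      using skew_shape_peak[of k l n w] l k w by (simp add: A_def A'_def)
    have "bij_betw ((`) ((-`) (collapse (int k)))) (ci_tilings A') without_p"
      unfolding without_p_def A p_def
    proof (rule ci_tilings_vimage)
      fix y assume "(int k, y) \<in> A'"
      then have y: "odd (int k + y)" "height l k < y" "y < h"
        by (simp_all add: A'_def mem_skew_shape h_def)
      then show "y < h \<and> even (h - 1 - y)" using ev by auto
      then have "y \<noteq> h - 2" by auto
      then have "y = h - 1 \<or> y + 2 < h" using y(3) by linarith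
      then show "y = h - 1 \<or> (int k, y + 2) \<in> A'"
        using y k by (auto simp: A'_def mem_skew_shape h_def)
    qed
    then have "card without_p = card (ci_tilings A')" using bij_betw_same_card by metis
    moreover have "even (card A) \<longleftrightarrow> even (card A')"
      using even_card_collapse[of A' "int k"] by (simp add: A A'_def)
    then have "(-1 :: int) ^ card A = (-1) ^ card A'" by (simp add: minus_one_power_iff)
    moreover have "below n l w" using below_peak_iff[of k l n w] True l k w by simp
    ultimately have "(-1) ^ card A * int (card without_p) = signed_count n l w"
      by (simp add: signed_count_def A'_def)
    then show ?thesis unfolding sum if_P[OF peak] l_def .
  next
    case False
    have "without_p = {}"
      using no_single_imp_peak[OF lam w k True] False
      by (auto simp: without_p_def p_def h_def A_def)
    then show ?thesis using False sum by simp
  qed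
qed

section \<open>The signed counts invert the matrix\<close>

lemma signed_count_not_bpe:
  assumes "lam \<in> bpe n" "mu \<notin> bpe n" "length mu = 2 * n" "height mu (2 * n) = 0"
  shows "signed_count n lam mu = 0"
proof -
  have "\<not> below n lam mu"
    using assms unfolding bpe_iff below_def by (meson order_trans)
  then show ?thesis by (simp add: signed_count_def)
qed

text \<open>Choose a peak of \<open>mu\<close>, say \<open>mu = peak k w\<close>. By \<open>obtained_from_peak\<close>, the nonzero entries of
  the column \<open>mu\<close> of the matrix come in pairs \<open>peak k rho\<close>, \<open>valley k rho\<close> with \<open>rho\<close> running
  through the nonzero entries of the column \<open>w\<close>. By the recurrence, each pair contributes the
  entry of the smaller matrix at \<open>rho\<close>, or 0, so the product reduces to the one for \<open>n\<close>.\<close>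

lemma signed_count_left_inverse:
  assumes "lam \<in> bpe n" "mu \<in> bpe n"
  shows "(\<Sum>rho\<in>bpe n. signed_count n lam rho * bpe_matrix rho mu) = (if lam = mu then 1 else 0)"
  using assms
proof (induction n arbitrary: lam mu)
  case 0
  have bpe0: "bpe 0 = {[]}" by (auto simp: bpe_iff)
  have "skew_shape 0 [] [] = {}" by (auto simp: skew_shape_def height_def)
  then have "signed_count 0 [] [] = 1" by (simp add: signed_count_def below_def)
  moreover have "[] \<leftarrow> []" by (auto simp: obtained_from_def reverse_pairs_def)
  ultimately show ?case using 0 by (simp add: bpe0 bpe_matrix_def)
next
  case (Suc n)
  obtain k w where k: "k \<le> length w" and mu: "mu = peak k w" and w: "w \<in> bpe n"
    using bpe_has_peak[OF Suc.prems(2)] by metis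
  have len: "length lam = 2 * Suc n" "length w = 2 * n" using Suc.prems w by (simp_all add: bpe_iff)
  define R where "R = {rho \<in> bpe n. rho \<leftarrow> w}"
  have kR: "k \<le> length rho" "length rho = 2 * n" if "rho \<in> R" for rho
    using that k len by (auto simp: R_def bpe_iff)
  let ?N = "signed_count (Suc n) lam"
  have "(\<Sum>rho\<in>bpe (Suc n). ?N rho * bpe_matrix rho mu) = (\<Sum>rho | rho \<in> bpe (Suc n) \<and> rho \<leftarrow> mu. ?N rho)"
    by (rule sum.mono_neutral_cong_right) (auto simp: bpe_matrix_def)
  also have "\<dots> = (\<Sum>rho\<in>peak k ` R \<union> valley k ` R. ?N rho)"
  proof (rule sum.mono_neutral_left)
    show "finite (peak k ` R \<union> valley k ` R)" by (simp add: R_def)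
    show "{rho \<in> bpe (Suc n). rho \<leftarrow> mu} \<subseteq> peak k ` R \<union> valley k ` R"
    proof
      fix rho assume "rho \<in> {rho \<in> bpe (Suc n). rho \<leftarrow> mu}"
      then obtain q where q: "q \<leftarrow> w" "rho = peak k q \<or> rho = valley k q" and rho: "rho \<in> bpe (Suc n)"
        using obtained_from_peak[OF k] mu by auto
      have "k \<le> length q" using obtained_from_length[OF q(1)] k by simp
      then have "q \<in> bpe n" using q(2) rho peak_in_bpe_iff valley_in_bpe_imp by metis
      then show "rho \<in> peak k ` R \<union> valley k ` R" using q by (auto simp: R_def)
    qed
    \<comment> \<open>Some \<open>valley k rho\<close> may not be balanced, but no path \<open>lam\<close> lies below such a word.\<close>
    show "\<forall>rho\<in>peak k ` R \<union> valley k ` R - {rho \<in> bpe (Suc n). rho \<leftarrow> mu}. ?N rho = 0"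
    proof
      fix rho assume rho: "rho \<in> peak k ` R \<union> valley k ` R - {rho \<in> bpe (Suc n). rho \<leftarrow> mu}"
      then obtain q where q: "q \<in> R" "rho = peak k q \<or> rho = valley k q" by auto
      then have "rho \<leftarrow> mu" using obtained_from_peak[OF k] mu by (auto simp: R_def)
      then have nb: "rho \<notin> bpe (Suc n)" using rho by auto
      have "height q (2 * n) = 0" using q(1) by (simp add: R_def bpe_iff)
      then have "length rho = 2 * Suc n" "height rho (2 * Suc n) = 0"
        using q kR[OF q(1)] by (auto simp: height_peak height_valley)
      then show "?N rho = 0" using signed_count_not_bpe[OF Suc.prems(1) nb] by simp
    qed
  qed
  also have "\<dots> = (\<Sum>rho\<in>R. ?N (peak k rho)) + (\<Sum>rho\<in>R. ?N (valley k rho))"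
  proof -
    have "peak k a = peak k b \<longleftrightarrow> a = b" "valley k a = valley k b \<longleftrightarrow> a = b"
      "peak k a \<noteq> valley k b" if "a \<in> R" "b \<in> R" for a b
    proof -
      have ab: "k \<le> length a" "k \<le> length b" using that kR by auto
      show "peak k a = peak k b \<longleftrightarrow> a = b" using ab contract_peak by metis
      have "contract k (valley k c) = c" if "k \<le> length c" for c
        using that by (simp add: valley_def contract_def)
      then show "valley k a = valley k b \<longleftrightarrow> a = b" using ab by metis
      show "peak k a \<noteq> valley k b" using nth_peak(2)[OF ab(1)] nth_valley(2)[OF ab(2)] by auto
    qed
    then have "inj_on (peak k) R" "inj_on (valley k) R" "peak k ` R \<inter> valley k ` R = {}"
      by (auto simp: inj_on_def)
    then show ?thesis
      by (simp add: sum.union_disjoint sum.reindex R_def)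
  qed
  also have "\<dots> = (\<Sum>rho\<in>R. ?N (peak k rho) + ?N (valley k rho))"
    by (rule sum.distrib[symmetric])
  also have "\<dots> = (\<Sum>rho\<in>R. if lam = peak k (contract k lam) then signed_count n (contract k lam) rho else 0)"
    using kR by (intro sum.cong refl signed_count_recurrence len(1)) auto
  also have "\<dots> = (if lam = mu then 1 else 0)"
  proof (cases "lam = peak k (contract k lam)")
    case True
    define l where "l = contract k lam"
    have l: "lam = peak k l" "k \<le> length l" using True k len by (simp_all add: l_def contract_def)
    then have lb: "l \<in> bpe n" using Suc.prems(1) peak_in_bpe_iff by metis
    have "(\<Sum>rho\<in>R. signed_count n l rho) = (\<Sum>rho\<in>bpe n. signed_count n l rho * bpe_matrix rho w)"
      by (rule sum.mono_neutral_cong_left) (auto simp: R_def bpe_matrix_def)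
    also have "\<dots> = (if l = w then 1 else 0)" by (rule Suc.IH[OF lb w])
    also have "\<dots> = (if lam = mu then 1 else 0)"
      using l mu k contract_peak by metis
    finally show ?thesis unfolding if_P[OF True] l_def .
  next
    case False
    then have "lam \<noteq> mu" using mu k contract_peak by metis
    then show ?thesis using False by simp
  qed
  finally show ?case .
qed

lemma signed_count_diag: "signed_count n lam lam = 1"
proof -
  have "skew_shape n lam lam = {}" by (auto simp: skew_shape_def)
  then show ?thesis by (simp add: signed_count_def below_def)
qed

text \<open>Unitriangularity: in the row of a path of maximal area in the support of \<open>v\<close>, only the diagonal
  term survives.\<close>

lemma signed_count_injective:
  assumes zero: "\<And>lam. lam \<in> bpe n \<Longrightarrow> (\<Sum>rho\<in>bpe n. signed_count n lam rho * v rho) = 0"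
    and "lam \<in> bpe n"
  shows "v lam = 0"
proof (rule ccontr)
  assume "v lam \<noteq> 0"
  define H where "H rho = (\<Sum>i\<le>2 * n. height rho i)" for rho
  let ?Z = "{rho \<in> bpe n. v rho \<noteq> 0}"
  have "finite ?Z" "lam \<in> ?Z" using assms(2) \<open>v lam \<noteq> 0\<close> by auto
  then have fin: "finite (H ` ?Z)" and "Max (H ` ?Z) \<in> H ` ?Z" by (auto intro!: Max_in)
  then obtain r where r: "r \<in> ?Z" and "H r = Max (H ` ?Z)" by force
  then have max: "H s \<le> H r" if "s \<in> ?Z" for s
    using Max_ge[OF fin imageI[OF that]] by simp
  have "signed_count n r s * v s = (if s = r then v r else 0)" if s: "s \<in> bpe n" for s
  proof (cases "s = r \<or> v s = 0 \<or> \<not> below n r s")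
    case True
    moreover have "signed_count n r s = 0" if "\<not> below n r s"
      using that by (simp add: signed_count_def)
    moreover have "below n r r" by (simp add: below_def)
    ultimately show ?thesis by (auto simp: signed_count_diag)
  next
    case False
    then have le: "\<forall>i\<le>2 * n. height r i \<le> height s i" and "H s \<le> H r"
      using max s by (auto simp: below_def)
    have "height r i = height s i" if "i \<le> 2 * n" for i
    proof (rule ccontr)
      assume "height r i \<noteq> height s i"
      then have "H r < H s"
        unfolding H_def using le that by (intro sum_strict_mono_ex1) (auto simp: order_less_le)
      then show False using \<open>H s \<le> H r\<close> by simp
    qed
    then have "r = s" using r s by (intro height_eqI) (auto simp: bpe_iff)
    then show ?thesis using False by simp
  qed
  then have "(\<Sum>rho\<in>bpe n. signed_count n r rho * v rho) = v r"
    using r by simp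
  then show False using zero[of r] r by simp
qed

text \<open>A right inverse is obtained from the left inverse \<open>N\<close> of the matrix \<open>M\<close>: the columns of
  \<open>M * N - 1\<close> are annihilated by \<open>N\<close>, since \<open>N * M * N = N\<close>, and \<open>N\<close> is injective.\<close>

lemma signed_count_inverse: "is_matrix_inverse_on (bpe n) bpe_matrix (signed_count n)"
proof -
  let ?N = "signed_count n" and ?M = bpe_matrix and ?I = "bpe n"
  have "(\<Sum>k\<in>?I. ?M i k * ?N k j) - (if i = j then 1 else 0) = 0" if i: "i \<in> ?I" and j: "j \<in> ?I" for i j
  proof (rule signed_count_injective[OF _ i])
    fix lam assume lam: "lam \<in> ?I"
    have "(\<Sum>r\<in>?I. ?N lam r * (\<Sum>k\<in>?I. ?M r k * ?N k j)) =
        (\<Sum>k\<in>?I. (\<Sum>r\<in>?I. ?N lam r * ?M r k) * ?N k j)"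
      unfolding sum_distrib_left sum_distrib_right mult.assoc by (rule sum.swap)
    also have "\<dots> = (\<Sum>k\<in>?I. if lam = k then ?N k j else 0)"
      using lam by (intro sum.cong) (simp_all add: signed_count_left_inverse)
    also have "\<dots> = ?N lam j" using lam by simp
    also have "\<dots> = (\<Sum>r\<in>?I. ?N lam r * (if r = j then 1 else 0))"
      using j by (simp add: if_distrib cong: if_cong)
    finally show "(\<Sum>r\<in>?I. ?N lam r * ((\<Sum>k\<in>?I. ?M r k * ?N k j) - (if r = j then 1 else 0))) = 0"
      by (simp add: right_diff_distrib sum_subtractf)
  qed
  then show ?thesis
    unfolding is_matrix_inverse_on_def by (simp add: signed_count_left_inverse)
qed

theorem theorem1p5:
  fixes n :: nat and lam mu :: "paren list"
  assumes "lam \<in> bpe n" and "mu \<in> bpe n"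
    and "\<forall>i\<le>2 * n. height lam i \<le> height mu i"
  shows "bpe_matrix_inverse n lam mu =
    (-1) ^ card (skew_shape n lam mu) *
    int (card {D. dyck_tiling n lam mu D \<and> cover_inclusive D})"
proof -
  have "bpe_matrix_inverse n lam mu = signed_count n lam mu"
    unfolding bpe_matrix_inverse_def
    by (rule matrix_inverse_on_eq[OF finite_bpe signed_count_inverse assms(1,2)])
  then show ?thesis
    using assms(3) by (simp add: signed_count_def below_def ci_tilings_def dyck_tiling_def conj_assoc)
qed

end
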